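(* Let $l,m,n_1,n_2$ be positive integers with $n_1\le l$, $n_1\le m$ and $n_2\le m$. Let $g\in G_{l,m}^{(n_1)}$ be a random matrix drawn from the Pólya ensemble associated to a weight $\omega\in\mathcal{P}^1_{n_1-1}$, and let $x\in H_m^{(n_2)}$ be a fixed matrix with non-zero and non-degenerate (pairwise distinct) eigenvalues $a=\mathrm{diag}(a_1,\ldots,a_{n_2})\in D_{n_2}$. Define $$\begin{aligned}p_j(\tilde{a})=&\ \tilde a^j,\\ q_j^{\geq}(\tilde{a})=&\frac{(m+j-n_2)!}{(m-n_1)!(n_1+j-n_2)!}\sum_{c=1}^{n_2} \frac{e_{n_2-j-1}(-a_{\neq c})}{\prod_{h\neq c}(a_c-a_h)}\frac{\tilde{\omega}_\geq(\tilde{a}|a_c)}{\mathcal{M}\omega(n_1+j-n_2+1)},\\ q_j^{<}(\tilde{a})=&\frac{(m+j-n_1)!}{(m-n_1)!\,j!}\sum_{c=1}^{n_2} \frac{e_{n_1-j-1}(-a_{\neq c})}{\prod_{h\neq c}(a_c-a_h)}\frac{\tilde{\omega}_<(\tilde{a}|a_c)}{\mathcal{M}\omega(j+1)}.\end{aligned}$$ Then, for the polynomial ensemble of the eigenvalues of $gxg^*$, $\{p_j,q_j^\geq\}_{j=0,\ldots,n_2-1}$ is a bi-orthonormal set when $n_1\geq n_2$, and $\{p_j,q_j^<\}_{j=0,\ldots,n_1-1}$ is a bi-orthonormal set when $n_1<n_2$. Hence the kernels are $$K_{n_2}^{\geq}(\tilde{a}_1,\tilde{a}_2)=\sum_{j=0}^{n_2-1}\sum_{c=1}^{n_2}\frac{(m+j-n_2)!}{(m-n_1)!(n_1+j-n_2)!}\frac{e_{n_2-j-1}(-a_{\neq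 c})}{\prod_{h\neq c}(a_c-a_h)}\frac{\tilde{a}_1^{j}\ \tilde{\omega}_\geq(\tilde{a}_2|a_c)}{\mathcal{M}\omega(n_1+j-n_2+1)}$$ for $n_1\geq n_2$, and $$K_{n_1}^<(\tilde{a}_1,\tilde{a}_2)=\sum_{j=0}^{n_1-1}\sum_{c=1}^{n_2}\frac{(m+j-n_1)!}{(m-n_1)!\,j!}\frac{e_{n_1-j-1}(-a_{\neq c})}{\prod_{h\neq c}(a_c-a_h)}\frac{\tilde{a}_1^{j}\ \tilde{\omega}_<(\tilde{a}_2|a_c)}{\mathcal{M}\omega(j+1)}$$ for $n_1<n_2$.
   Context: Matrices and measures. $K_n=\mathrm{U}(n)$ with normalized Haar measure $d^*k$; $D_n\simeq(\mathbb{R}\setminus\{0\})^n$ and $A_n\simeq\mathbb{R}_+^n$ are the invertible real, respectively positive, diagonal $n\times n$ matrices with Lebesgue measure; $\Pi_{n,m}$ is the $n\times m$ matrix with entries $\delta_{ij}$; $\Delta_n(a)=\prod_{n\ge c>d\ge1}(a_c-a_d)$; $g^*$ is the Hermitian adjoint. $G_{l,m}^{(n)}$ is the set of complex $l\times m$ matrices of rank $n$, with the measure that is the image of $dg\,d^*k\,d^*\tilde k$ ($dg$ Lebesgue on $\mathrm{GL}_n(\mathbb{C})$, $k\in K_l$, $\tilde k\in K_m$) under $(g,k,\tilde k)\mapsto k\Pi_{l,n}g\Pi_{n,m}\tilde k^*$. $H_l^{(n)}$ is the set of Hermitian $l\times l$ matrices of rank $n$, with the measure that is the image of $dx\,d^*k$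 ($dx$ Lebesgue on invertible Hermitian $n\times n$ matrices, $k\in K_l$) under $(x,k)\mapsto k\Pi_{l,n}x\Pi_{n,l}k^*$. A density on $G_{l,m}^{(n)}$ is $K$-invariant if it is invariant under $g\mapsto k_1gk_2$, $k_1\in K_l,k_2\in K_m$; a density on $H_l^{(n)}$ is $K$-invariant if it is invariant under $x\mapsto kxk^*$, $k\in K_l$. Joint densities are those of the unordered non-zero eigenvalues or squared singular values. Mellin transform. For $f$ on $\mathbb{R}_+$: $\mathcal{M}f(s)=\int_0^\infty dx\,x^{s-1}f(x)$. For $f$ on $\mathbb{R}$, $L\in\{0,1\}$ (read modulo 2): $\mathcal{M}f(s,L)=\int_{\mathbb{R}}\frac{dx}{|x|}[\mathrm{sign}(x)]^L|x|^sf(x)$. Function classes. $L^1_k(\mathbb{I})$ is the set of $f\in L^1(\mathbb{I})$ with $\int_{\mathbb I}|x^jf(x)|dx<\infty$ for all $j\in[0,k]$. $\mathcal{P}^1_k$ is the set of $f\in L^1_k(\mathbb{R}_+)$ such that $f\circ\exp$ is $k$-times differentiable and a Pólya frequency function of order $k$, and $(x\partial)^jf\in L^1_k(\mathbb{R}_+)$ for $j=0,\ldots,k$. A Pólya frequency function of order $k$ is a real non-zero function $f$ on $\mathbb{R}$ with $\Delta_j(x)\Delta_j(y)\det[f(x_b-y_c)]_{b,c=1,\ldots,j}\ge0$ for all $x,y\in\mathbb{R}^j$, $j=1,\ldots,k$. Ensembles. A Pólya ensemble on $G_{l,m}^{(n)}$ associated to $\omega\in\mathcal{P}^1_{n-1}$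 is a $K$-invariant random matrix in $G_{l,m}^{(n)}$ whose squared (non-zero) singular values $a\in A_n$ have the probability density $p_A(a)=\frac{1}{\prod_{j=1}^nj!\,\mathcal{M}\omega(j)}\Delta_n(a)\det[(-a_c\partial_c)^{b-1}\omega(a_c)]_{b,c=1,\ldots,n}$. A polynomial ensemble on $H_m^{(n)}$ associated to $w_1,\ldots,w_n\in L^1_{n-1}(\mathbb{R})$ is a $K$-invariant random matrix in $H_m^{(n)}$ whose non-zero eigenvalues $a\in D_n$ have the probability density $p_D(a)=\frac{1}{n!}\Delta_n(a)\frac{\det[w_b(a_c)]_{b,c=1,\ldots,n}}{\det[\mathcal{M}w_b(c,c-1)]_{b,c=1,\ldots,n}}$. For such an ensemble, functions $\{p_j,q_j\}_{j=0,\ldots,n-1}$ are bi-orthonormal if $\{p_j\}$ is a basis of the span of the monomials $1,x,\ldots,x^{n-1}$, $\{q_j\}$ is a basis of the span of the weights $w_1,\ldots,w_n$, and $\int da\,p_j(a)q_i(a)=\delta_{ji}$ for all $i,j=0,\ldots,n-1$. The kernel is $K_n(a_1,a_2)=\sum_{j=0}^{n-1}p_j(a_1)q_j(a_2)$; it gives the $\kappa$-point correlation functions $R_\kappa(a_1,\ldots,a_\kappa)=\frac{n!}{(n-\kappa)!}\int p_D(a)\prod_{j=\kappa+1}^nda_j=\det[K_n(a_b,a_c)]_{b,c=1,\ldots,\kappa}$. Weights. $\Theta$ is the Heaviside step function. $\omega_k^{(0)}(a)=k(1-a)^{k-1}\Theta(1-a)$ for $k>0$ and $\omega_0^{(0)}(a)=\delta(a-1)$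 (so the integrals below are evaluated at $a'=1$ if $m=n_1$). For $\tilde a\in\mathbb{R}$, $a_c\in\mathbb{R}\setminus\{0\}$, $$\tilde{\omega}_\geq(\tilde{a}|a_c)=\Theta(\tilde{a}a_c)\left(\frac{\tilde{a}}{a_c}\right)^{n_1-n_2}\int_0^\infty \frac{d a'}{|a_c|a'}\omega_{m-n_1}^{(0)}(a')\,\omega\left(\frac{\tilde{a}}{a_ca'}\right),\qquad \tilde{\omega}_<(\tilde{a}|a_c)=\Theta(\tilde{a}a_c)\,a_c^{n_2-n_1}\int_0^\infty \frac{d a'}{|a_c|a'}\omega_{m-n_1}^{(0)}(a')\,\omega\left(\frac{\tilde{a}}{a_ca'}\right).$$ $a_{\neq j}=\mathrm{diag}(a_1,\ldots,a_{j-1},a_{j+1},\ldots,a_{n_2})$, and $e_o(-a_{\neq j})=\oint\frac{dz}{2\pi i\,z^{n_2-o}}\prod_{h\neq j}(z-a_h)$ (counter-clockwise around the origin) is the elementary symmetric polynomial of order $o\le n_2-1$ in the elements $-a_h$, $h\neq j$. The eigenvalues of $gxg^*$ form a polynomial ensemble on $H_l^{(\min\{n_1,n_2\})}$, associated to the weights $\tilde\omega_\geq(\,\cdot\,|a_c)$, $c=1,\ldots,n_2$, if $n_1\ge n_2$, and to the weights $\sum_{c=1}^{n_2}\frac{e_{n_1-b}(-a_{\neq c})}{\prod_{h\neq c}(a_c-a_h)}\tilde\omega_<(\,\cdot\,|a_c)$, $b=1,\ldots,n_1$, if $n_1<n_2$. *)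

theory Defs
  imports "HOL-Probability.Probability" "Jordan_Normal_Form.Determinant"
begin

(* The symbol $ denotes access to the components of the type-indexed vectors of HOL-Analysis. *)
no_notation vec_index (infixl "$" 100)

(* Vectors in R^n are functions on {..<n}; all indices are shifted to start at 0. *)

definition det_n :: "nat \<Rightarrow> (nat \<Rightarrow> nat \<Rightarrow> 'a::comm_ring_1) \<Rightarrow> 'a" where
  "det_n n A = Determinant.det (Matrix.mat n n (\<lambda>(b, c). A b c))"

definition vandermonde :: "nat \<Rightarrow> (nat \<Rightarrow> real) \<Rightarrow> real" where
  "vandermonde n a = (\<Prod>c<n. \<Prod>d<c. a c - a d)"

definition hadj :: "complex ^ 'm ^ 'l \<Rightarrow> complex ^ 'l ^ 'm" where
  "hadj g = (\<chi> i j. cnj (g $ j $ i))"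

definition unitary_group :: "(complex ^ 'n ^ 'n) set" where
  "unitary_group = {k. k ** hadj k = Finite_Cartesian_Product.mat 1 \<and>
                       hadj k ** k = Finite_Cartesian_Product.mat 1}"

(* Normalized Haar measure, as a measure on the ambient matrix space concentrated on U(n). *)
definition haar_unitary :: "(complex ^ 'n ^ 'n) measure" where
  "haar_unitary = (THE \<mu>. sets \<mu> = sets borel \<and> prob_space \<mu> \<and> emeasure \<mu> unitary_group = 1 \<and>
     (\<forall>k\<in>unitary_group. distr \<mu> borel (\<lambda>u. k ** u) = \<mu>))"

(* pad n z is Pi_{l,n} z Pi_{n,m}: the n x n matrix z in the upper left corner of an l x m matrix.
   The finite index types are numbered by to_nat_on UNIV; unitary invariance makes the measures
   below independent of the numbering. *)
definition pad :: "nat \<Rightarrow> (nat \<Rightarrow> nat \<Rightarrow> complex) \<Rightarrow> complex ^ 'm ^ 'l" where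
  "pad n z = (\<chi> i j. let b = to_nat_on (UNIV :: 'l set) i; c = to_nat_on (UNIV :: 'm set) j
                in if b < n \<and> c < n then z b c else 0)"

definition lebesgue_GL :: "nat \<Rightarrow> (nat \<times> nat \<Rightarrow> complex) measure" where
  "lebesgue_GL n = restrict_space (PiM ({..<n} \<times> {..<n}) (\<lambda>_. lborel))
                     {z. det_n n (curry z) \<noteq> 0}"

(* The Hermitian matrix with real diagonal entries z (b, b) and, for b < c, real and imaginary part
   z (b, c) and z (c, b) of the entry at (b, c). *)
definition herm_entries :: "(nat \<times> nat \<Rightarrow> real) \<Rightarrow> nat \<Rightarrow> nat \<Rightarrow> complex" where
  "herm_entries z b c = (if b = c then of_real (z (b, b))
     else if b < c then Complex (z (b, c)) (z (c, b))
     else Complex (z (c, b)) (- z (b, c)))"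

definition lebesgue_Herm :: "nat \<Rightarrow> (nat \<times> nat \<Rightarrow> real) measure" where
  "lebesgue_Herm n = restrict_space (PiM ({..<n} \<times> {..<n}) (\<lambda>_. lborel))
                       {z. det_n n (herm_entries z) \<noteq> 0}"

definition G_set :: "nat \<Rightarrow> (complex ^ 'm ^ 'l) set" where
  "G_set n = {g. rank g = n}"

definition H_set :: "nat \<Rightarrow> (complex ^ 'l ^ 'l) set" where
  "H_set n = {x. hadj x = x \<and> rank x = n}"

(* The reference measures on G_set n and H_set n, as measures on the ambient matrix spaces. *)
definition G_measure :: "nat \<Rightarrow> (complex ^ 'm ^ 'l) measure" where
  "G_measure n = distr (lebesgue_GL n \<Otimes>\<^sub>M (haar_unitary \<Otimes>\<^sub>M haar_unitary)) borel
     (\<lambda>(z, k, k'). k ** pad n (curry z) ** hadj k')"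

definition H_measure :: "nat \<Rightarrow> (complex ^ 'l ^ 'l) measure" where
  "H_measure n = distr (lebesgue_Herm n \<Otimes>\<^sub>M haar_unitary) borel
     (\<lambda>(z, k). k ** pad n (herm_entries z) ** hadj k)"

definition K_invariant_G :: "'s measure \<Rightarrow> nat \<Rightarrow> ('s \<Rightarrow> complex ^ 'm ^ 'l) \<Rightarrow> bool" where
  "K_invariant_G M n g \<longleftrightarrow> (\<exists>f. distributed M (G_measure n) g f \<and>
     (\<forall>k1\<in>unitary_group. \<forall>k2\<in>unitary_group. \<forall>y\<in>G_set n. f (k1 ** y ** k2) = f y))"

definition K_invariant_H :: "'s measure \<Rightarrow> nat \<Rightarrow> ('s \<Rightarrow> complex ^ 'l ^ 'l) \<Rightarrow> bool" where
  "K_invariant_H M n Y \<longleftrightarrow> (\<exists>f. distributed M (H_measure n) Y f \<and>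
     (\<forall>k\<in>unitary_group. \<forall>y\<in>H_set n. f (k ** y ** hadj k) = f y))"

(* a enumerates the n non-zero eigenvalues of x, with multiplicity, as the non-zero roots of the
   characteristic polynomial. *)
definition nonzero_eigenvalues :: "nat \<Rightarrow> complex ^ 'l ^ 'l \<Rightarrow> (nat \<Rightarrow> real) \<Rightarrow> bool" where
  "nonzero_eigenvalues n x a \<longleftrightarrow> n \<le> CARD('l) \<and> (\<forall>c<n. a c \<noteq> 0) \<and>
     (\<forall>z. Determinants.det (Finite_Cartesian_Product.mat z - x)
          = z ^ (CARD('l) - n) * (\<Prod>c<n. z - of_real (a c)))"

(* p is the joint probability density on I^n of n unordered random points: it is symmetric and gives the
   probability of every permutation-invariant event. "E s a" says that a enumerates the points at
   the outcome s. *)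
definition unordered_density ::
  "'s measure \<Rightarrow> nat \<Rightarrow> real set \<Rightarrow> ('s \<Rightarrow> (nat \<Rightarrow> real) \<Rightarrow> bool) \<Rightarrow> ((nat \<Rightarrow> real) \<Rightarrow> real) \<Rightarrow> bool"
where
  "unordered_density M n I E p \<longleftrightarrow>
     (let N = PiM {..<n} (\<lambda>_. restrict_space lborel I) in
        p \<in> borel_measurable N \<and> (AE a in N. 0 \<le> p a) \<and> (\<integral>\<^sup>+a. ennreal (p a) \<partial>N) = 1 \<and>
        (\<forall>a\<in>space N. \<forall>\<pi>. \<pi> permutes {..<n} \<longrightarrow> p (a \<circ> \<pi>) = p a) \<and>
        (\<forall>B\<in>sets N. (\<forall>a\<in>B. \<forall>\<pi>. \<pi> permutes {..<n} \<longrightarrow> a \<circ> \<pi> \<in> B) \<longrightarrow>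
           {s \<in> space M. \<exists>a\<in>B. E s a} \<in> sets M \<and>
           emeasure M {s \<in> space M. \<exists>a\<in>B. E s a} = (\<integral>\<^sup>+a\<in>B. ennreal (p a) \<partial>N)))"

definition squared_singular_value_density ::
  "'s measure \<Rightarrow> nat \<Rightarrow> ('s \<Rightarrow> complex ^ 'm ^ 'l) \<Rightarrow> ((nat \<Rightarrow> real) \<Rightarrow> real) \<Rightarrow> bool" where
  "squared_singular_value_density M n g p \<longleftrightarrow>
     unordered_density M n {0<..} (\<lambda>s. nonzero_eigenvalues n (g s ** hadj (g s))) p"

definition eigenvalue_density ::
  "'s measure \<Rightarrow> nat \<Rightarrow> ('s \<Rightarrow> complex ^ 'l ^ 'l) \<Rightarrow> ((nat \<Rightarrow> real) \<Rightarrow> real) \<Rightarrow> bool" where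
  "eigenvalue_density M n Y p \<longleftrightarrow>
     unordered_density M n (- {0}) (\<lambda>s. nonzero_eigenvalues n (Y s)) p"

definition mellin :: "(real \<Rightarrow> real) \<Rightarrow> real \<Rightarrow> real" where
  "mellin f s = (LINT x:{0<..}|lborel. x powr (s - 1) * f x)"

definition mellin_sgn :: "(real \<Rightarrow> real) \<Rightarrow> real \<Rightarrow> nat \<Rightarrow> real" where
  "mellin_sgn f s L = (LINT x|lborel. sgn x ^ (L mod 2) * \<bar>x\<bar> powr s * f x / \<bar>x\<bar>)"

definition L1_class :: "nat \<Rightarrow> real set \<Rightarrow> (real \<Rightarrow> real) set" where
  "L1_class k I = {f. set_integrable lborel I f \<and>
     (\<forall>j\<in>{0..real k}. set_integrable lborel I (\<lambda>x. \<bar>x\<bar> powr j * f x))}"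

definition polya_frequency :: "nat \<Rightarrow> (real \<Rightarrow> real) \<Rightarrow> bool" where
  "polya_frequency k f \<longleftrightarrow> (\<exists>x. f x \<noteq> 0) \<and>
     (\<forall>j\<in>{1..k}. \<forall>x y. vandermonde j x * vandermonde j y * det_n j (\<lambda>b c. f (x b - y c)) \<ge> 0)"

definition times_differentiable :: "nat \<Rightarrow> (real \<Rightarrow> real) \<Rightarrow> bool" where
  "times_differentiable k f \<longleftrightarrow> (\<forall>j<k. \<forall>x. (deriv ^^ j) f differentiable at x)"

definition euler_op :: "(real \<Rightarrow> real) \<Rightarrow> real \<Rightarrow> real" where
  "euler_op f x = x * deriv f x"

definition polya_class :: "nat \<Rightarrow> (real \<Rightarrow> real) set" where
  "polya_class k = {f. f \<in> L1_class k {0<..} \<and>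
     times_differentiable k (f \<circ> exp) \<and> polya_frequency k (f \<circ> exp) \<and>
     (\<forall>j\<le>k. (euler_op ^^ j) f \<in> L1_class k {0<..})}"

definition polya_density :: "nat \<Rightarrow> (real \<Rightarrow> real) \<Rightarrow> (nat \<Rightarrow> real) \<Rightarrow> real" where
  "polya_density n \<omega> a = 1 / (\<Prod>j=1..n. fact j * mellin \<omega> (real j)) * vandermonde n a *
     det_n n (\<lambda>b c. ((\<lambda>f t. - euler_op f t) ^^ b) \<omega> (a c))"

definition polya_ensemble ::
  "'s measure \<Rightarrow> nat \<Rightarrow> (real \<Rightarrow> real) \<Rightarrow> ('s \<Rightarrow> complex ^ 'm ^ 'l) \<Rightarrow> bool" where
  "polya_ensemble M n \<omega> g \<longleftrightarrow> prob_space M \<and> \<omega> \<in> polya_class (n - 1) \<and>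
     K_invariant_G M n g \<and> squared_singular_value_density M n g (polya_density n \<omega>)"

definition polynomial_density :: "nat \<Rightarrow> (nat \<Rightarrow> real \<Rightarrow> real) \<Rightarrow> (nat \<Rightarrow> real) \<Rightarrow> real" where
  "polynomial_density n w a = 1 / fact n * vandermonde n a * det_n n (\<lambda>b c. w b (a c)) /
     det_n n (\<lambda>b c. mellin_sgn (w b) (real (c + 1)) c)"

definition polynomial_ensemble ::
  "'s measure \<Rightarrow> nat \<Rightarrow> (nat \<Rightarrow> real \<Rightarrow> real) \<Rightarrow> ('s \<Rightarrow> complex ^ 'l ^ 'l) \<Rightarrow> bool" where
  "polynomial_ensemble M n w Y \<longleftrightarrow> prob_space M \<and> (\<forall>b<n. w b \<in> L1_class (n - 1) UNIV) \<and>
     K_invariant_H M n Y \<and> eigenvalue_density M n Y (polynomial_density n w)"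

definition fun_span :: "nat \<Rightarrow> (nat \<Rightarrow> real \<Rightarrow> real) \<Rightarrow> (real \<Rightarrow> real) set" where
  "fun_span n u = {f. \<exists>\<gamma>. f = (\<lambda>x. \<Sum>j<n. \<gamma> j * u j x)}"

definition fun_independent :: "nat \<Rightarrow> (nat \<Rightarrow> real \<Rightarrow> real) \<Rightarrow> bool" where
  "fun_independent n u \<longleftrightarrow> (\<forall>\<gamma>. (\<forall>x. (\<Sum>j<n. \<gamma> j * u j x) = 0) \<longrightarrow> (\<forall>j<n. \<gamma> j = 0))"

definition basis_of_span :: "nat \<Rightarrow> (nat \<Rightarrow> real \<Rightarrow> real) \<Rightarrow> (nat \<Rightarrow> real \<Rightarrow> real) \<Rightarrow> bool" where
  "basis_of_span n u v \<longleftrightarrow> fun_independent n u \<and> fun_span n u = fun_span n v"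

(* The integral is required to exist, since the library's integral defaults to 0. *)
definition bi_orthonormal ::
  "nat \<Rightarrow> (nat \<Rightarrow> real \<Rightarrow> real) \<Rightarrow> (nat \<Rightarrow> real \<Rightarrow> real) \<Rightarrow> (nat \<Rightarrow> real \<Rightarrow> real) \<Rightarrow> bool" where
  "bi_orthonormal n w p q \<longleftrightarrow> basis_of_span n p (\<lambda>j x. x ^ j) \<and> basis_of_span n q w \<and>
     (\<forall>i<n. \<forall>j<n. has_bochner_integral lborel (\<lambda>t. p j t * q i t) (if j = i then 1 else 0))"

definition kernel ::
  "nat \<Rightarrow> (nat \<Rightarrow> real \<Rightarrow> real) \<Rightarrow> (nat \<Rightarrow> real \<Rightarrow> real) \<Rightarrow> real \<Rightarrow> real \<Rightarrow> real" where
  "kernel n p q t1 t2 = (\<Sum>j<n. p j t1 * q j t2)"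

(* All correlation functions of the joint density P of n points are determinants of K. *)
definition is_correlation_kernel ::
  "nat \<Rightarrow> ((nat \<Rightarrow> real) \<Rightarrow> real) \<Rightarrow> (real \<Rightarrow> real \<Rightarrow> real) \<Rightarrow> bool" where
  "is_correlation_kernel n P K \<longleftrightarrow> (\<forall>\<kappa>\<in>{1..n}. \<forall>a.
     has_bochner_integral (PiM {\<kappa>..<n} (\<lambda>_. lborel))
       (\<lambda>z. fact n / fact (n - \<kappa>) * P (\<lambda>i. if i < \<kappa> then a i else z i))
       (det_n \<kappa> (\<lambda>b c. K (a b) (a c))))"

(* The n non-zero eigenvalues of Y form a determinantal point process with kernel K. *)
definition has_eigenvalue_kernel ::
  "'s measure \<Rightarrow> nat \<Rightarrow> ('s \<Rightarrow> complex ^ 'l ^ 'l) \<Rightarrow> (real \<Rightarrow> real \<Rightarrow> real) \<Rightarrow> bool" where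
  "has_eigenvalue_kernel M n Y K \<longleftrightarrow>
     (\<exists>P. eigenvalue_density M n Y P \<and> is_correlation_kernel n P K)"

(* The Heaviside step function; its value at 0 is a convention that makes the weights below vanish
   at 0, so that the weight on the positive axis is never evaluated outside of it. *)
definition heaviside :: "real \<Rightarrow> real" where
  "heaviside t = (if t > 0 then 1 else 0)"

(* The integral of omega_k^(0)(s) F(s) ds over s > 0, where omega_0^(0) is the delta at 1. *)
definition omega0_integral :: "nat \<Rightarrow> (real \<Rightarrow> real) \<Rightarrow> real" where
  "omega0_integral k F = (if k = 0 then F 1
     else (LINT s:{0<..}|lborel. real k * (1 - s) ^ (k - 1) * heaviside (1 - s) * F s))"

(* The exponents n1 - n2 and n2 - n1 are subtractions of naturals: the first weight is only used for
   n1 >= n2, the second one for n1 < n2. *)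
definition weight_ge ::
  "nat \<Rightarrow> nat \<Rightarrow> nat \<Rightarrow> (real \<Rightarrow> real) \<Rightarrow> real \<Rightarrow> real \<Rightarrow> real" where
  "weight_ge m n1 n2 \<omega> \<alpha> t = heaviside (t * \<alpha>) * (t / \<alpha>) ^ (n1 - n2) *
     omega0_integral (m - n1) (\<lambda>s. 1 / (\<bar>\<alpha>\<bar> * s) * \<omega> (t / (\<alpha> * s)))"

definition weight_lt ::
  "nat \<Rightarrow> nat \<Rightarrow> nat \<Rightarrow> (real \<Rightarrow> real) \<Rightarrow> real \<Rightarrow> real \<Rightarrow> real" where
  "weight_lt m n1 n2 \<omega> \<alpha> t = heaviside (t * \<alpha>) * \<alpha> ^ (n2 - n1) *
     omega0_integral (m - n1) (\<lambda>s. 1 / (\<bar>\<alpha>\<bar> * s) * \<omega> (t / (\<alpha> * s)))"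

(* Elementary symmetric polynomial of order r in the elements -a h, h < n2, h \<noteq> c. *)
definition esym_without :: "nat \<Rightarrow> (nat \<Rightarrow> real) \<Rightarrow> nat \<Rightarrow> nat \<Rightarrow> real" where
  "esym_without n2 a c r = (\<Sum>S | S \<subseteq> {..<n2} - {c} \<and> card S = r. \<Prod>h\<in>S. - a h)"

definition esym_ratio :: "nat \<Rightarrow> (nat \<Rightarrow> real) \<Rightarrow> nat \<Rightarrow> nat \<Rightarrow> real" where
  "esym_ratio n2 a c r = esym_without n2 a c r / (\<Prod>h\<in>{..<n2} - {c}. a c - a h)"

(* The weights of the ensemble of the eigenvalues of g x g^*; there are n2 of them if n1 >= n2 and
   n1 of them if n1 < n2. *)
definition weights_ge ::
  "nat \<Rightarrow> nat \<Rightarrow> nat \<Rightarrow> (real \<Rightarrow> real) \<Rightarrow> (nat \<Rightarrow> real) \<Rightarrow> nat \<Rightarrow> real \<Rightarrow> real" where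
  "weights_ge m n1 n2 \<omega> a c t = weight_ge m n1 n2 \<omega> (a c) t"

definition weights_lt ::
  "nat \<Rightarrow> nat \<Rightarrow> nat \<Rightarrow> (real \<Rightarrow> real) \<Rightarrow> (nat \<Rightarrow> real) \<Rightarrow> nat \<Rightarrow> real \<Rightarrow> real" where
  "weights_lt m n1 n2 \<omega> a b t =
     (\<Sum>c<n2. esym_ratio n2 a c (n1 - (b + 1)) * weight_lt m n1 n2 \<omega> (a c) t)"

definition q_ge ::
  "nat \<Rightarrow> nat \<Rightarrow> nat \<Rightarrow> (real \<Rightarrow> real) \<Rightarrow> (nat \<Rightarrow> real) \<Rightarrow> nat \<Rightarrow> real \<Rightarrow> real" where
  "q_ge m n1 n2 \<omega> a j t =
     fact (m + j - n2) / (fact (m - n1) * fact (n1 + j - n2)) *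
     (\<Sum>c<n2. esym_ratio n2 a c (n2 - j - 1) *
        weight_ge m n1 n2 \<omega> (a c) t / mellin \<omega> (real (n1 + j - n2 + 1)))"

definition q_lt ::
  "nat \<Rightarrow> nat \<Rightarrow> nat \<Rightarrow> (real \<Rightarrow> real) \<Rightarrow> (nat \<Rightarrow> real) \<Rightarrow> nat \<Rightarrow> real \<Rightarrow> real" where
  "q_lt m n1 n2 \<omega> a j t =
     fact (m + j - n1) / (fact (m - n1) * fact j) *
     (\<Sum>c<n2. esym_ratio n2 a c (n1 - j - 1) *
        weight_lt m n1 n2 \<omega> (a c) t / mellin \<omega> (real (j + 1)))"

end

(* Substituting t = a_c s u in the weights turns their moments into products: the j-th moment of the
   weight at a_c is a_c^j (or a_c^(j + n2 - n1)) times a Beta integral times a Mellin moment of omega.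
   The elementary symmetric polynomials over Vandermonde factors are the coefficients of the Lagrange
   basis polynomials, i.e. the inverse of the Vandermonde matrix, so they diagonalise these moments.
   The moments of omega do not vanish because the Polya density is normalised.
   Since the density is det[K(a_b, a_c)] / n!, integrating out variables one at a time yields the
   correlation functions. *)
theory Submission
  imports Defs
begin

subsection \<open>Determinants\<close>

text \<open>The prefactors of \<open>q_ge\<close> and \<open>q_lt\<close> are the reciprocals of the
  factor of the moments that does not depend on the node: the Beta integral of the weight
  \<open>omega_k^(0)\<close> with \<open>k = m - n1\<close> times a Mellin moment of
  \<open>\<omega>\<close>. For \<open>n1 < n2\<close> there are more nodes than functions; the power
  \<open>\<alpha> ^ (n2 - n1)\<close> in the weight shifts the moments to the \<open>n1\<close>
  highest powers of the nodes, so the inverse of the full Vandermonde matrix of size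
  \<open>n2\<close> still applies, with \<open>j\<close> shifted by \<open>n2 - n1\<close>. The
  density takes the form of a kernel determinant because the coefficients of the weights in terms of
  the \<open>q j\<close> are, by duality, the moments of the weights: the normalising determinant is
  that of the change of basis and cancels. The cancellation holds at every point, as
  \<open>is_correlation_kernel\<close> fixes arbitrary values of the first \<open>\<kappa>\<close>
  points. A constraint throughout is that \<open>\<omega>\<close> is controlled on the positive axis
  only, while nodes may be negative. The Heaviside factor keeps its argument positive, and integrals
  are phrased with \<open>indicator {0<..} u * \<omega> u\<close>.\<close>

lemma det_n_leibniz:
  "det_n n A = (\<Sum>\<pi> | \<pi> permutes {..<n}. of_int (sign \<pi>) * (\<Prod>i<n. A i (\<pi> i)))"
proof -
  have "det_n n A = (\<Sum>\<pi> | \<pi> permutes {0..<n}. of_int (sign \<pi>) *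
      (\<Prod>i=0..<n. Matrix.mat n n (\<lambda>(b, c). A b c) $$ (i, \<pi> i)))"
    unfolding det_n_def by (rule det_def') simp
  also have "\<dots> = (\<Sum>\<pi> | \<pi> permutes {0..<n}. of_int (sign \<pi>) * (\<Prod>i=0..<n. A i (\<pi> i)))"
    by (intro sum.cong prod.cong arg_cong2[where f = "(*)"] refl)
       (auto dest: permutes_in_image)
  finally show ?thesis
    by (simp add: atLeast0LessThan)
qed

lemma det_n_cong: "(\<And>b c. b < n \<Longrightarrow> c < n \<Longrightarrow> A b c = B b c) \<Longrightarrow> det_n n A = det_n n B"
  unfolding det_n_def by (intro arg_cong[where f = Determinant.det] eq_matI) auto

lemma det_n_mult: "det_n n (\<lambda>b c. \<Sum>j<n. A b j * B j c) = det_n n A * det_n n B"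
proof -
  have "Matrix.mat n n (\<lambda>(b, c). \<Sum>j<n. A b j * B j c) =
      Matrix.mat n n (\<lambda>(b, c). A b c) * Matrix.mat n n (\<lambda>(b, c). B b c)"
    by (intro eq_matI) (auto simp: scalar_prod_def atLeast0LessThan)
  then show ?thesis
    unfolding det_n_def by (simp add: det_mult[of _ n])
qed

lemma det_n_transpose: "det_n n (\<lambda>b c. A c b) = det_n n A"
proof -
  have "Matrix.mat n n (\<lambda>(b, c). A c b) = transpose_mat (Matrix.mat n n (\<lambda>(b, c). A b c))"
    by (intro eq_matI) auto
  then show ?thesis
    unfolding det_n_def using det_transpose[of "Matrix.mat n n (\<lambda>(b, c). A b c)" n] by simp
qed

lemma det_n_lower_triangular:
  assumes "\<And>b c. b < c \<Longrightarrow> c < n \<Longrightarrow> A b c = 0"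
  shows "det_n n A = (\<Prod>b<n. A b b)"
proof -
  have "det_n n A = prod_list (diag_mat (Matrix.mat n n (\<lambda>(b, c). A b c)))"
    unfolding det_n_def by (rule det_lower_triangular[of n]) (use assms in auto)
  also have "\<dots> = (\<Prod>b<n. A b b)"
    by (simp add: prod_list_diag_prod atLeast0LessThan)
  finally show ?thesis .
qed

lemma det_n_one: "det_n n (\<lambda>b c. if b = c then 1 else 0) = 1"
  by (subst det_n_lower_triangular) auto

text \<open>In the Newton basis \<open>P c\<close>, which vanishes at \<open>a d\<close> for
  \<open>d < c\<close>, the evaluation matrix is lower triangular and its diagonal multiplies to
  \<open>vandermonde\<close>. Each \<open>P c\<close> is monic of degree \<open>c\<close>, so
  passing from monomials to this basis has determinant 1.\<close>

lemma det_n_vandermonde: "det_n n (\<lambda>b c. a b ^ c) = vandermonde n a"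
proof -
  define P where "P c = (\<Prod>d<c. [:- a d, 1:])" for c
  have deg: "degree (P c) = c" for c
    unfolding P_def by (subst degree_prod_eq_sum_degree) auto
  have lead: "poly.coeff (P c) c = 1" for c
    using lead_coeff_prod[of "\<lambda>d. [:- a d, 1:]" "{..<c}"] deg[of c] by (simp add: P_def)
  have "vandermonde n a = (\<Prod>b<n. poly (P b) (a b))"
    by (simp add: vandermonde_def P_def poly_prod)
  also have "\<dots> = det_n n (\<lambda>b c. poly (P c) (a b))"
    by (subst det_n_lower_triangular) (auto simp: P_def poly_prod)
  also have "\<dots> = det_n n (\<lambda>b c. \<Sum>j<n. a b ^ j * poly.coeff (P c) j)"
  proof (rule det_n_cong)
    fix b c assume "b < n" "c < n"
    have "poly (P c) (a b) = (\<Sum>j\<le>c. poly.coeff (P c) j * a b ^ j)"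
      by (simp add: poly_altdef deg)
    also have "\<dots> = (\<Sum>j<n. a b ^ j * poly.coeff (P c) j)"
      using \<open>c < n\<close> by (intro sum.mono_neutral_cong_left)
        (auto simp: coeff_eq_0 deg mult.commute)
    finally show "poly (P c) (a b) = (\<Sum>j<n. a b ^ j * poly.coeff (P c) j)" .
  qed
  also have "\<dots> = det_n n (\<lambda>b c. a b ^ c) * det_n n (\<lambda>b c. poly.coeff (P c) b)"
    by (rule det_n_mult)
  also have "det_n n (\<lambda>b c. poly.coeff (P c) b) = 1"
    by (subst det_n_transpose[symmetric], subst det_n_lower_triangular)
       (auto simp: coeff_eq_0 deg lead)
  finally show ?thesis by simp
qed

subsection \<open>Integrating out variables of a determinantal density\<close>

text \<open>The permutations of \<open>{..k}\<close> that do not fix \<open>k\<close> arise from permutations of \<open>{..<k}\<close> by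
  splicing \<open>k\<close> into a cycle. Integrating over the last variable contracts that cycle again
  (with the opposite sign), and a fixed point contributes the trace.\<close>
lemma has_bochner_integral_det_n_last:
  fixes K :: "real \<Rightarrow> real \<Rightarrow> real"
  assumes tr: "has_bochner_integral lborel (\<lambda>t. K t t) \<tau>"
    and proj: "\<And>y z. has_bochner_integral lborel (\<lambda>t. K y t * K t z) (K y z)"
  shows "has_bochner_integral lborel (\<lambda>t. det_n (Suc k) (\<lambda>b c. K ((x(k := t)) b) ((x(k := t)) c)))
           ((\<tau> - real k) * det_n k (\<lambda>b c. K (x b) (x c)))"
proof -
  define D where "D = (\<lambda>q. of_int (sign q) * (\<Prod>i<k. K (x i) (x (q i))))"
  define T where "T = (\<lambda>t \<pi>. of_int (sign \<pi>) *
    (\<Prod>i<Suc k. K ((x(k := t)) i) ((x(k := t)) (\<pi> i))))"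
  have split: "det_n (Suc k) (\<lambda>b c. K ((x(k := t)) b) ((x(k := t)) c)) =
      (\<Sum>b<Suc k. \<Sum>q | q permutes {..<k}. T t (Transposition.transpose k b \<circ> q))" for t
    unfolding det_n_leibniz T_def lessThan_Suc
    by (rule sum_over_permutations_insert) auto
  have fixed: "has_bochner_integral lborel (\<lambda>t. T t (Transposition.transpose k k \<circ> q)) (\<tau> * D q)"
    if q: "q permutes {..<k}" for q
  proof -
    have "q k = k" using q by (simp add: permutes_def)
    have "T t (Transposition.transpose k k \<circ> q) = D q * K t t" for t
    proof -
      have "(\<Prod>i<k. K ((x(k := t)) i) ((x(k := t)) (q i))) = (\<Prod>i<k. K (x i) (x (q i)))"
        using q by (intro prod.cong refl) (auto dest: permutes_in_image)
      then show ?thesis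
        by (simp add: T_def D_def \<open>q k = k\<close>)
    qed
    then show ?thesis
      using has_bochner_integral_mult_right[OF tr, of "D q"] by (simp add: mult.commute)
  qed
  have moved: "has_bochner_integral lborel (\<lambda>t. T t (Transposition.transpose k b \<circ> q)) (- D q)"
    if q: "q permutes {..<k}" and b: "b < k" for q b
  proof -
    have "q k = k" using q by (simp add: permutes_def)
    \<comment> \<open>\<open>i0\<close> is the predecessor of \<open>b\<close> under
      \<open>q\<close>. The spliced permutation sends \<open>i0\<close> to \<open>k\<close> and
      \<open>k\<close> to \<open>b\<close>, so \<open>t\<close> occurs exactly in
      \<open>K (x i0) t\<close> and \<open>K t (x b)\<close>; integrating it out restores the factor
      of \<open>q\<close> at \<open>i0\<close>.\<close>
    define i0 where "i0 = Hilbert_Choice.inv q b"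
    have qi0: "q i0 = b" unfolding i0_def using q by (simp add: permutes_inverses)
    have i0: "i0 < k" using permutes_in_image[OF q, of i0] qi0 b by simp
    have inj: "q i = b \<longleftrightarrow> i = i0" for i
      using qi0 permutes_inj[OF q] by (auto dest: injD)
    have "sign (Transposition.transpose k b \<circ> q) = - sign q"
      using b permutation_permutes q by (subst sign_compose)
        (auto simp: sign_swap_id permutation_swap_id)
    define C where "C = (\<Prod>i\<in>{..<k} - {i0}. K (x i) (x (q i)))"
    have T: "T t (Transposition.transpose k b \<circ> q) = (- of_int (sign q) * C) * (K (x i0) t * K t (x b))" for t
    proof -
      have "(\<Prod>i<Suc k. K ((x(k := t)) i) ((x(k := t)) ((Transposition.transpose k b \<circ> q) i))) =
          (\<Prod>i<k. K ((x(k := t)) i) ((x(k := t)) ((Transposition.transpose k b \<circ> q) i))) * K t (x b)"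
        using b by (simp add: \<open>q k = k\<close>)
      also have "(\<Prod>i<k. K ((x(k := t)) i) ((x(k := t)) ((Transposition.transpose k b \<circ> q) i))) =
          K (x i0) t * (\<Prod>i\<in>{..<k} - {i0}. K ((x(k := t)) i) ((x(k := t)) ((Transposition.transpose k b \<circ> q) i)))"
        using i0 by (subst prod.remove[of _ i0]) (auto simp: qi0)
      also have "(\<Prod>i\<in>{..<k} - {i0}. K ((x(k := t)) i) ((x(k := t)) ((Transposition.transpose k b \<circ> q) i))) = C"
        unfolding C_def
      proof (intro prod.cong refl)
        fix i assume i: "i \<in> {..<k} - {i0}"
        have "q i < k" using i permutes_in_image[OF q, of i] by simp
        moreover have "q i \<noteq> b" using i by (simp add: inj)
        ultimately show "K ((x(k := t)) i) ((x(k := t)) ((Transposition.transpose k b \<circ> q) i)) = K (x i) (x (q i))"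
          using i by (simp add: Transposition.transpose_def)
      qed
      finally have prod: "(\<Prod>i<Suc k. K ((x(k := t)) i) ((x(k := t)) ((Transposition.transpose k b \<circ> q) i))) =
          K (x i0) t * C * K t (x b)" .
      show ?thesis
        unfolding T_def prod \<open>sign (Transposition.transpose k b \<circ> q) = - sign q\<close> by simp
    qed
    have "D q = of_int (sign q) * C * K (x i0) (x b)"
      unfolding D_def C_def using i0 by (subst prod.remove[of _ i0]) (auto simp: qi0)
    then show ?thesis
      unfolding T using has_bochner_integral_mult_right[OF proj[of "x i0" "x b"], of "- of_int (sign q) * C"]
      by simp
  qed
  have "has_bochner_integral lborel
      (\<lambda>t. (\<Sum>q | q permutes {..<k}. T t (Transposition.transpose k k \<circ> q)) +
           (\<Sum>b<k. \<Sum>q | q permutes {..<k}. T t (Transposition.transpose k b \<circ> q)))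
      ((\<Sum>q | q permutes {..<k}. \<tau> * D q) + (\<Sum>b<k. \<Sum>q | q permutes {..<k}. - D q))"
    by (intro has_bochner_integral_add has_bochner_integral_sum fixed moved) auto
  moreover have "(\<Sum>q | q permutes {..<k}. \<tau> * D q) + (\<Sum>b<k. \<Sum>q | q permutes {..<k}. - D q) =
      (\<tau> - real k) * det_n k (\<lambda>b c. K (x b) (x c))"
  proof -
    have "det_n k (\<lambda>b c. K (x b) (x c)) = sum D {q. q permutes {..<k}}"
      by (simp add: det_n_leibniz D_def)
    then show ?thesis
      by (simp add: sum_distrib_left[symmetric] sum_negf left_diff_distrib)
  qed
  ultimately show ?thesis
    unfolding split by (simp add: add.commute)
qed

text \<open>Fubini needs joint integrability at every stage, hence a general size \<open>k\<close>
  besides the number \<open>n\<close> of functions. Once all sums are expanded, each free variable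
  occurs in one \<open>p\<close> (from its row) and one \<open>q\<close> (from its column), so every
  term is a product of integrable functions of one variable.\<close>

lemma integrable_PiM_det_n_kernel:
  fixes p q :: "nat \<Rightarrow> real \<Rightarrow> real"
  assumes int: "\<And>i j. i < n \<Longrightarrow> j < n \<Longrightarrow> integrable lborel (\<lambda>t. p j t * q i t)"
    and \<kappa>: "\<kappa> \<le> k"
  shows "integrable (PiM {\<kappa>..<k} (\<lambda>_. lborel))
    (\<lambda>z. det_n k (\<lambda>b c. kernel n p q (if b < \<kappa> then a b else z b) (if c < \<kappa> then a c else z c)))"
proof -
  interpret product_sigma_finite "\<lambda>_::nat. lborel :: real measure"
    by standard
  define X where "X z i = (if i < \<kappa> then a i else z i :: real)" for z i
  have expand: "(\<Prod>i<k. kernel n p q (X z i) (X z (\<pi> i))) =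
      (\<Sum>f\<in>PiE {..<k} (\<lambda>_. {..<n}). (\<Prod>i<\<kappa>. p (f i) (a i) * q (f (Hilbert_Choice.inv \<pi> i)) (a i)) *
         (\<Prod>i\<in>{\<kappa>..<k}. p (f i) (z i) * q (f (Hilbert_Choice.inv \<pi> i)) (z i)))"
    if \<pi>: "\<pi> permutes {..<k}" for \<pi> z
  proof -
    have "(\<Prod>i<k. kernel n p q (X z i) (X z (\<pi> i))) =
        (\<Sum>f\<in>PiE {..<k} (\<lambda>_. {..<n}). \<Prod>i<k. p (f i) (X z i) * q (f i) (X z (\<pi> i)))"
      unfolding kernel_def by (rule prod_sum_PiE) auto
    also have "\<dots> = (\<Sum>f\<in>PiE {..<k} (\<lambda>_. {..<n}). (\<Prod>i<\<kappa>. p (f i) (a i) * q (f (Hilbert_Choice.inv \<pi> i)) (a i)) *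
         (\<Prod>i\<in>{\<kappa>..<k}. p (f i) (z i) * q (f (Hilbert_Choice.inv \<pi> i)) (z i)))"
    proof (rule sum.cong[OF refl])
      fix f
      \<comment> \<open>Reindexing along \<open>\<pi>\<close> collects both factors that contain the
        \<open>i\<close>-th point.\<close>
      have "(\<Prod>i<k. q (f i) (X z (\<pi> i))) = (\<Prod>i<k. q (f (Hilbert_Choice.inv \<pi> i)) (X z i))"
        using prod.permute[OF \<pi>, of "\<lambda>i. q (f (Hilbert_Choice.inv \<pi> i)) (X z i)"] \<pi>
        by (simp add: o_def permutes_inverses)
      then have "(\<Prod>i<k. p (f i) (X z i) * q (f i) (X z (\<pi> i))) =
          (\<Prod>i<k. p (f i) (X z i) * q (f (Hilbert_Choice.inv \<pi> i)) (X z i))"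
        by (simp add: prod.distrib)
      also have "\<dots> = (\<Prod>i<\<kappa>. p (f i) (X z i) * q (f (Hilbert_Choice.inv \<pi> i)) (X z i)) *
          (\<Prod>i\<in>{\<kappa>..<k}. p (f i) (X z i) * q (f (Hilbert_Choice.inv \<pi> i)) (X z i))"
        using \<kappa> by (subst prod.union_disjoint[symmetric]) (auto intro!: prod.cong)
      finally show "(\<Prod>i<k. p (f i) (X z i) * q (f i) (X z (\<pi> i))) =
          (\<Prod>i<\<kappa>. p (f i) (a i) * q (f (Hilbert_Choice.inv \<pi> i)) (a i)) *
          (\<Prod>i\<in>{\<kappa>..<k}. p (f i) (z i) * q (f (Hilbert_Choice.inv \<pi> i)) (z i))"
        by (simp add: X_def)
    qed
    finally show ?thesis .
  qed
  have "integrable (PiM {\<kappa>..<k} (\<lambda>_. lborel)) (\<lambda>z. det_n k (\<lambda>b c. kernel n p q (X z b) (X z c)))"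
    unfolding det_n_leibniz
  proof (intro Bochner_Integration.integrable_sum integrable_mult_right)
    fix \<pi> assume "\<pi> \<in> {\<pi>. \<pi> permutes {..<k}}"
    then have \<pi>: "\<pi> permutes {..<k}" by simp
    show "integrable (PiM {\<kappa>..<k} (\<lambda>_. lborel)) (\<lambda>z. \<Prod>i<k. kernel n p q (X z i) (X z (\<pi> i)))"
      unfolding expand[OF \<pi>]
    proof (intro Bochner_Integration.integrable_sum integrable_mult_right product_integrable_prod int)
      fix f i assume "f \<in> PiE {..<k} (\<lambda>_. {..<n})" "i \<in> {\<kappa>..<k}"
      moreover from this have "i \<in> {..<k}" "Hilbert_Choice.inv \<pi> i \<in> {..<k}"
        using permutes_in_image[OF permutes_inv[OF \<pi>], of i] by auto
      ultimately show "f i < n" "f (Hilbert_Choice.inv \<pi> i) < n"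
        by (blast dest: PiE_mem)+
    qed simp
  qed
  then show ?thesis
    by (simp add: X_def)
qed

text \<open>Bi-orthonormality makes the kernel reproducing with trace \<open>n\<close>, so passing
  from size \<open>k + 1\<close> to size \<open>k\<close> costs the factor \<open>n - k\<close>.
  These factors multiply to \<open>fact (n - \<kappa>)\<close>.\<close>

lemma has_bochner_integral_det_n_kernel:
  fixes p q :: "nat \<Rightarrow> real \<Rightarrow> real"
  assumes bi: "\<And>i j. i < n \<Longrightarrow> j < n \<Longrightarrow>
      has_bochner_integral lborel (\<lambda>t. p j t * q i t) (if j = i then 1 else 0)"
    and \<kappa>: "\<kappa> \<le> n"
  shows "has_bochner_integral (PiM {\<kappa>..<n} (\<lambda>_. lborel))
    (\<lambda>z. det_n n (\<lambda>b c. kernel n p q (if b < \<kappa> then a b else z b) (if c < \<kappa> then a c else z c)))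
    (fact (n - \<kappa>) * det_n \<kappa> (\<lambda>b c. kernel n p q (a b) (a c)))"
proof -
  interpret product_sigma_finite "\<lambda>_::nat. lborel :: real measure"
    by standard
  define X where "X z i = (if i < \<kappa> then a i else z i :: real)" for z i
  define F where "F k z = det_n k (\<lambda>b c. kernel n p q (X z b) (X z c))" for k z
  have int: "integrable (PiM {\<kappa>..<k} (\<lambda>_. lborel)) (F k)" if "\<kappa> \<le> k" for k
    unfolding F_def X_def
    by (rule integrable_PiM_det_n_kernel[OF _ that]) (use bi has_bochner_integral_iff in blast)
  have "has_bochner_integral lborel (\<lambda>t. kernel n p q t t) (\<Sum>j<n. 1)"
    unfolding kernel_def by (intro has_bochner_integral_sum) (use bi in fastforce)
  then have tr: "has_bochner_integral lborel (\<lambda>t. kernel n p q t t) (real n)"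
    by simp
  have proj: "has_bochner_integral lborel (\<lambda>t. kernel n p q y t * kernel n p q t z) (kernel n p q y z)"
    for y z
  proof -
    have "has_bochner_integral lborel (\<lambda>t. \<Sum>j<n. \<Sum>i<n. (p j y * q j t) * (p i t * q i z))
        (\<Sum>j<n. \<Sum>i<n. p j y * q i z * (if i = j then 1 else 0))"
    proof (intro has_bochner_integral_sum)
      fix i j assume "i \<in> {..<n}" "j \<in> {..<n}"
      then show "has_bochner_integral lborel (\<lambda>t. (p j y * q j t) * (p i t * q i z))
          (p j y * q i z * (if i = j then 1 else 0))"
        using has_bochner_integral_mult_right[OF bi[of j i], of "p j y * q i z"] by (simp add: mult_ac)
    qed
    moreover have "(\<Sum>j<n. \<Sum>i<n. p j y * q i z * (if i = j then 1 else 0)) = kernel n p q y z"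
      unfolding kernel_def by (intro sum.cong refl) (auto simp: if_distrib cong: if_cong)
    ultimately show ?thesis
      by (simp add: kernel_def sum_product)
  qed
  have step: "integral\<^sup>L (PiM {\<kappa>..<Suc k} (\<lambda>_. lborel)) (F (Suc k)) =
      (real n - real k) * integral\<^sup>L (PiM {\<kappa>..<k} (\<lambda>_. lborel)) (F k)" if "\<kappa> \<le> k" for k
  proof -
    have ins: "{\<kappa>..<Suc k} = insert k {\<kappa>..<k}"
      using that by auto
    have "integral\<^sup>L (PiM {\<kappa>..<Suc k} (\<lambda>_. lborel)) (F (Suc k)) =
        (\<integral>z. (\<integral>t. F (Suc k) (z(k := t)) \<partial>lborel) \<partial>PiM {\<kappa>..<k} (\<lambda>_. lborel))"
      using int[of "Suc k"] that unfolding ins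
      by (subst product_integral_insert) auto
    also have "\<dots> = (\<integral>z. (real n - real k) * F k z \<partial>PiM {\<kappa>..<k} (\<lambda>_. lborel))"
    proof (intro Bochner_Integration.integral_cong refl)
      fix z
      have "X (z(k := t)) = (X z)(k := t)" for t
        using that by (auto simp: X_def)
      then show "(\<integral>t. F (Suc k) (z(k := t)) \<partial>lborel) = (real n - real k) * F k z"
        unfolding F_def
        using has_bochner_integral_det_n_last[OF tr proj, of k "X z"]
        by (simp add: has_bochner_integral_iff)
    qed
    finally show ?thesis by simp
  qed
  \<comment> \<open>\<open>d\<close> counts the integrated variables. With
    \<open>fact (n - (\<kappa> + d))\<close> on the left, the right side does not depend on
    \<open>d\<close>; at \<open>d = n - \<kappa>\<close> this factor is 1.\<close>
  have "integral\<^sup>L (PiM {\<kappa>..<\<kappa> + d} (\<lambda>_. lborel)) (F (\<kappa> + d)) * fact (n - (\<kappa> + d)) =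
      fact (n - \<kappa>) * det_n \<kappa> (\<lambda>b c. kernel n p q (a b) (a c))" if "\<kappa> + d \<le> n" for d
    using that
  proof (induction d)
    case 0
    have "F \<kappa> z = det_n \<kappa> (\<lambda>b c. kernel n p q (a b) (a c))" for z
      unfolding F_def by (rule det_n_cong) (simp add: X_def)
    then show ?case
      by (simp add: PiM_empty lebesgue_integral_count_space_finite)
  next
    case (Suc d)
    have "fact (n - (\<kappa> + d)) = (real n - real (\<kappa> + d)) * fact (n - (\<kappa> + Suc d))"
      using Suc.prems by (subst fact_reduce) (auto simp: of_nat_diff Suc_diff_Suc)
    then show ?case
      using Suc step[of "\<kappa> + d"] by (simp add: mult_ac)
  qed
  from this[of "n - \<kappa>"] have "integral\<^sup>L (PiM {\<kappa>..<n} (\<lambda>_. lborel)) (F n) =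
      fact (n - \<kappa>) * det_n \<kappa> (\<lambda>b c. kernel n p q (a b) (a c))"
    using \<kappa> by simp
  then show ?thesis
    using int[OF \<kappa>] by (simp add: has_bochner_integral_iff F_def[abs_def] X_def)
qed

subsection \<open>Moments of multiplicative convolutions\<close>

lemma heaviside_measurable [measurable]: "heaviside \<in> borel_measurable borel"
  unfolding heaviside_def[abs_def] by measurable

text \<open>At fixed \<open>s > 0\<close>, rescaling \<open>u\<close> by \<open>s\<close> pulls out
  \<open>s ^ i\<close>, and its Jacobian cancels \<open>1 / s\<close>; Fubini then separates the two
  moments. The same rescaling of absolute values gives joint integrability.\<close>

lemma has_bochner_integral_mellin_convolution:
  fixes v W :: "real \<Rightarrow> real"
  assumes [measurable]: "v \<in> borel_measurable borel" "W \<in> borel_measurable borel"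
    and W: "has_bochner_integral lborel (\<lambda>u. u ^ i * W u) A"
    and v: "has_bochner_integral lborel (\<lambda>s. s ^ i * v s) B"
    and v0: "\<And>s. s \<le> 0 \<Longrightarrow> v s = 0"
  shows "has_bochner_integral lborel (\<lambda>u. u ^ i * (LINT s|lborel. v s * (1 / s * W (u / s)))) (B * A)"
proof -
  define f where "f = (\<lambda>(s, u). u ^ i * (v s * (1 / s * W (u / s))))"
  have [measurable]: "f \<in> borel_measurable (lborel \<Otimes>\<^sub>M lborel)"
    unfolding f_def by measurable
  have scale: "has_bochner_integral lborel (\<lambda>u. h (u / s)) (s * I)"
    if h: "has_bochner_integral lborel h I" and "s > 0" for h :: "real \<Rightarrow> real" and I s
    using h \<open>s > 0\<close> lborel_has_bochner_integral_real_affine_iff[of "1 / s" h I 0]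
    by (simp add: field_simps)
  have inner: "has_bochner_integral lborel (\<lambda>u. f (s, u)) (s ^ i * v s * A)" for s
  proof (cases "s > 0")
    case True
    have "f (s, u) = s ^ i * v s / s * ((u / s) ^ i * W (u / s))" for u
      using True by (simp add: f_def field_simps)
    then show ?thesis
      using has_bochner_integral_mult_right[OF scale[OF W True], of "s ^ i * v s / s"] True
      by (simp add: mult_ac)
  qed (simp add: f_def v0 has_bochner_integral_zero)
  have normW: "has_bochner_integral lborel (\<lambda>u. \<bar>u ^ i * W u\<bar>) (LINT u|lborel. \<bar>u ^ i * W u\<bar>)"
    using W by (auto simp: has_bochner_integral_iff)
  have inner_norm: "(LINT u|lborel. norm (f (s, u))) = \<bar>s ^ i * v s\<bar> * (LINT u|lborel. \<bar>u ^ i * W u\<bar>)"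
    for s
  proof (cases "s > 0")
    case True
    have "norm (f (s, u)) = \<bar>s ^ i * v s\<bar> / s * \<bar>(u / s) ^ i * W (u / s)\<bar>" for u
      using True by (simp add: f_def field_simps abs_mult power_abs)
    then show ?thesis
      using has_bochner_integral_mult_right[OF scale[OF normW True], of "\<bar>s ^ i * v s\<bar> / s"] True
      by (simp add: has_bochner_integral_iff)
  qed (simp add: f_def v0)
  have int: "integrable (lborel \<Otimes>\<^sub>M lborel) f"
  proof (rule lborel_pair.Fubini_integrable)
    show "integrable lborel (\<lambda>s. LINT u|lborel. norm (f (s, u)))"
      unfolding inner_norm using v by (auto simp: has_bochner_integral_iff)
    show "AE s in lborel. integrable lborel (\<lambda>u. f (s, u))"
      using inner by (auto simp: has_bochner_integral_iff)
  qed simp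
  then have int': "integrable (lborel \<Otimes>\<^sub>M lborel) (case_prod (\<lambda>s u. f (s, u)))"
    by simp
  have "integrable lborel (\<lambda>u. LINT s|lborel. f (s, u))"
    using lborel_pair.integrable_snd[OF int'] .
  moreover have "(LINT u|lborel. LINT s|lborel. f (s, u)) = (LINT s|lborel. LINT u|lborel. f (s, u))"
    using lborel_pair.Fubini_integral[OF int'] .
  moreover have "(LINT s|lborel. LINT u|lborel. f (s, u)) = B * A"
    using inner v by (simp add: has_bochner_integral_iff)
  moreover have "(LINT s|lborel. f (s, u)) = u ^ i * (LINT s|lborel. v s * (1 / s * W (u / s)))" for u
    unfolding f_def prod.case by (rule integral_mult_right_zero)
  ultimately show ?thesis
    by (simp only: has_bochner_integral_iff)
qed

lemma has_bochner_integral_beta_moment: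
  assumes "0 < k"
  shows "has_bochner_integral lborel
    (\<lambda>s. s ^ i * (indicator {0<..} s * (real k * (1 - s) ^ (k - 1) * heaviside (1 - s))))
    (fact k * fact i / fact (i + k))"
proof -
  have B: "Beta (real i + 1) (real k) = fact i * fact (k - 1) / fact (i + k)"
  proof -
    have "Gamma (real k) = fact (k - 1)"
      using Gamma_fact[of "k - 1", where 'a = real] assms by (simp add: of_nat_diff)
    moreover have "Gamma (real i + 1 + real k) = fact (i + k)"
      using Gamma_fact[of "i + k", where 'a = real] by (simp add: add_ac)
    moreover have "Gamma (real i + 1) = fact i"
      using Gamma_fact[of i, where 'a = real] by (simp add: add_ac)
    ultimately show ?thesis by (simp add: Beta_def)
  qed
  have "((\<lambda>t. t powr (real i + 1 - 1) * (1 - t) powr (real k - 1)) has_integral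
      fact i * fact (k - 1) / fact (i + k)) {0..1}"
    using has_integral_Beta_real[of "real i + 1" "real k"] assms B by simp
  \<comment> \<open>The open interval avoids the endpoints, where \<open>0 powr 0 = 0\<close>
    differs from \<open>0 ^ 0 = 1\<close>.\<close>
  then have "((\<lambda>t::real. t ^ i * (1 - t) ^ (k - 1)) has_integral fact i * fact (k - 1) / fact (i + k)) {0<..<1}"
    unfolding has_integral_Icc_iff_Ioo
  proof (rule has_integral_eq[rotated])
    fix t :: real assume t: "t \<in> {0<..<1}"
    have "real k - 1 = real (k - 1)"
      using assms by simp
    with t show "t powr (real i + 1 - 1) * (1 - t) powr (real k - 1) = t ^ i * (1 - t) ^ (k - 1)"
      by (simp add: powr_realpow del: of_nat_diff)
  qed
  then have hi: "((\<lambda>t::real. t ^ i * (1 - t) ^ (k - 1)) has_integral fact i * fact (k - 1) / fact (i + k)) {0..1}"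
    by (simp add: has_integral_Icc_iff_Ioo)
  have si: "set_integrable lborel {0..1} (\<lambda>t::real. t ^ i * (1 - t) ^ (k - 1))"
    by (intro borel_integrable_atLeastAtMost' continuous_intros)
  have "has_bochner_integral lborel (\<lambda>t::real. indicator {0..1} t * (t ^ i * (1 - t) ^ (k - 1)))
      (fact i * fact (k - 1) / fact (i + k))"
    using si set_borel_integral_eq_integral(2)[OF si] integral_unique[OF hi]
    by (simp add: has_bochner_integral_iff set_integrable_def set_lebesgue_integral_def)
  from has_bochner_integral_mult_right[OF this, of "real k"]
  have I: "has_bochner_integral lborel (\<lambda>t::real. real k * (indicator {0..1} t * (t ^ i * (1 - t) ^ (k - 1))))
      (fact k * fact i / fact (i + k))"
    using assms by (simp add: fact_reduce[of k] mult_ac)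
  show ?thesis
  proof (subst has_bochner_integral_cong_AE)
    show "AE s in lborel. s ^ i * (indicator {0<..} s * (real k * (1 - s) ^ (k - 1) * heaviside (1 - s))) =
        real k * (indicator {0..1} s * (s ^ i * (1 - s) ^ (k - 1)))"
      using AE_lborel_singleton[of 0] AE_lborel_singleton[of 1]
      by eventually_elim (auto simp: indicator_def heaviside_def)
  qed (use I in auto)
qed

lemma has_bochner_integral_omega0:
  assumes \<omega>: "has_bochner_integral lborel (\<lambda>u. u ^ i * (indicator {0<..} u * \<omega> u)) A"
    and meas: "(\<lambda>u. indicator {0<..} u * \<omega> u) \<in> borel_measurable borel"
  shows "has_bochner_integral lborel
    (\<lambda>u. u ^ i * (heaviside u * omega0_integral k (\<lambda>s. 1 / s * \<omega> (u / s))))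
    (fact k * fact i / fact (i + k) * A)"
proof (cases "k = 0")
  case True
  have "heaviside u = indicator {0<..} u" for u
    by (simp add: heaviside_def indicator_def)
  with \<omega> show ?thesis
    by (simp add: True omega0_integral_def)
next
  case False
  define v where "v = (\<lambda>s. indicator {0<..} s * (real k * (1 - s) ^ (k - 1) * heaviside (1 - s)))"
  have [measurable]: "v \<in> borel_measurable borel"
    unfolding v_def by measurable
  \<comment> \<open>Since \<open>v\<close> lives on \<open>s > 0\<close>, the quotient
    \<open>u / s\<close> has the sign of \<open>u\<close>. The outer cut-off can thus move inside,
    onto the argument of \<open>\<omega>\<close>, which gives a convolution of measurable
    functions.\<close>
  have "heaviside u * omega0_integral k (\<lambda>s. 1 / s * \<omega> (u / s)) =
      (LINT s|lborel. v s * (1 / s * (indicator {0<..} (u / s) * \<omega> (u / s))))" for u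
  proof (cases "u > 0")
    case True
    then show ?thesis
      using False
      by (auto simp: heaviside_def[of u] omega0_integral_def set_lebesgue_integral_def v_def
        intro!: Bochner_Integration.integral_cong split: split_indicator)
  next
    case u: False
    have zero: "v s * (1 / s * (indicator {0<..} (u / s) * \<omega> (u / s))) = 0" for s
      using u by (auto simp: v_def zero_less_divide_iff split: split_indicator)
    show ?thesis
      unfolding zero using u by (simp add: heaviside_def[of u])
  qed
  then show ?thesis
    using has_bochner_integral_mellin_convolution[OF _ meas \<omega>, of v "fact k * fact i / fact (i + k)"]
      has_bochner_integral_beta_moment[of k i] False
    by (simp add: v_def[symmetric]) (simp add: v_def)
qed

lemma omega0_integral_mult: "omega0_integral k (\<lambda>s. r * F s) = r * omega0_integral k F"
proof (cases "k = 0")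
  case False
  have "(LINT s:{0<..}|lborel. real k * (1 - s) ^ (k - 1) * heaviside (1 - s) * (r * F s)) =
      (LINT s:{0<..}|lborel. r * (real k * (1 - s) ^ (k - 1) * heaviside (1 - s) * F s))"
    by (simp add: mult_ac)
  with False show ?thesis
    by (simp add: omega0_integral_def)
qed (simp add: omega0_integral_def)

text \<open>The substitution \<open>t = \<alpha> * u\<close> reduces to the unit node for either
  sign of \<open>\<alpha>\<close>: the Heaviside argument becomes
  \<open>\<alpha>\<^sup>2 * u\<close>, the Jacobian cancels the
  \<open>1 / \<bar>\<alpha>\<bar>\<close> of the weight, and only \<open>\<alpha> ^ i\<close> keeps
  the sign.\<close>

lemma has_bochner_integral_scaled_weight:
  assumes \<omega>: "has_bochner_integral lborel (\<lambda>u. u ^ i * (indicator {0<..} u * \<omega> u)) A"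
    and meas: "(\<lambda>u. indicator {0<..} u * \<omega> u) \<in> borel_measurable borel"
    and \<alpha>: "\<alpha> \<noteq> 0"
  shows "has_bochner_integral lborel
    (\<lambda>t. t ^ i * (heaviside (t * \<alpha>) * omega0_integral k (\<lambda>s. 1 / (\<bar>\<alpha>\<bar> * s) * \<omega> (t / (\<alpha> * s)))))
    (\<alpha> ^ i * (fact k * fact i / fact (i + k) * A))"
    (is "has_bochner_integral _ ?f ?I")
proof -
  have "?f (0 + \<alpha> * u) = \<alpha> ^ i / \<bar>\<alpha>\<bar> *
      (u ^ i * (heaviside u * omega0_integral k (\<lambda>s. 1 / s * \<omega> (u / s))))" for u
  proof -
    have "heaviside ((0 + \<alpha> * u) * \<alpha>) = heaviside u"
    proof -
      have "(0 + \<alpha> * u) * \<alpha> = \<alpha>\<^sup>2 * u"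
        by (simp add: power2_eq_square)
      with \<alpha> show ?thesis
        by (simp only: heaviside_def) (simp add: zero_less_mult_iff)
    qed
    moreover have "omega0_integral k (\<lambda>s. 1 / (\<bar>\<alpha>\<bar> * s) * \<omega> ((0 + \<alpha> * u) / (\<alpha> * s))) =
        1 / \<bar>\<alpha>\<bar> * omega0_integral k (\<lambda>s. 1 / s * \<omega> (u / s))"
      using \<alpha> by (subst omega0_integral_mult[symmetric]) simp
    ultimately show ?thesis
      by (simp add: power_mult_distrib)
  qed
  then have "has_bochner_integral lborel (\<lambda>u. ?f (0 + \<alpha> * u)) (?I /\<^sub>R \<bar>\<alpha>\<bar>)"
    using has_bochner_integral_mult_right[OF has_bochner_integral_omega0[OF \<omega> meas, of k], of "\<alpha> ^ i / \<bar>\<alpha>\<bar>"]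
    by (simp add: divide_inverse mult_ac)
  then show ?thesis
    using lborel_has_bochner_integral_real_affine_iff[OF \<alpha>, of ?f ?I 0] by blast
qed

subsection \<open>Bi-orthonormality\<close>

lemma sum_esym_without:
  assumes "c < N"
  shows "(\<Sum>j<N. esym_without N a c (N - Suc j) * t ^ j) = (\<Prod>h\<in>{..<N} - {c}. t - a h)"
proof -
  define A where "A = {..<N} - {c}"
  have A: "finite A" "card A = N - 1"
    using assms by (auto simp: A_def)
  have "(\<Prod>h\<in>A. t - a h) = (\<Prod>h\<in>A. - a h + t)"
    by simp
  also have "\<dots> = (\<Sum>S\<in>Pow A. (\<Prod>h\<in>S. - a h) * t ^ card (A - S))"
    using prod_add[OF A(1), of "\<lambda>h. - a h" "\<lambda>_. t"] by simp
  also have "\<dots> = (\<Sum>j<N. \<Sum>S | S \<in> Pow A \<and> card (A - S) = j. (\<Prod>h\<in>S. - a h) * t ^ card (A - S))"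
  proof (rule sum.group[symmetric])
    have "card (A - S) < N" for S
      using card_mono[OF A(1), of "A - S"] A(2) assms by auto
    then show "(\<lambda>S. card (A - S)) ` Pow A \<subseteq> {..<N}" by auto
  qed (use A in auto)
  also have "\<dots> = (\<Sum>j<N. esym_without N a c (N - Suc j) * t ^ j)"
  proof (rule sum.cong[OF refl])
    fix j assume j: "j \<in> {..<N}"
    have "{S. S \<in> Pow A \<and> card (A - S) = j} = {S. S \<subseteq> A \<and> card S = N - Suc j}"
    proof -
      have "card (A - S) = j \<longleftrightarrow> card S = N - Suc j" if "S \<subseteq> A" for S
        using that A j card_mono[OF A(1) that] card_Diff_subset[OF finite_subset[OF that A(1)] that]
        by auto
      then show ?thesis by auto
    qed
    moreover have "(\<Sum>S | S \<in> Pow A \<and> card (A - S) = j. (\<Prod>h\<in>S. - a h) * t ^ card (A - S)) =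
        (\<Sum>S | S \<in> Pow A \<and> card (A - S) = j. (\<Prod>h\<in>S. - a h)) * t ^ j"
      by (simp add: sum_distrib_right)
    ultimately show "(\<Sum>S | S \<in> Pow A \<and> card (A - S) = j. (\<Prod>h\<in>S. - a h) * t ^ card (A - S)) =
        esym_without N a c (N - Suc j) * t ^ j"
      by (simp add: esym_without_def A_def)
  qed
  finally show ?thesis
    by (simp add: A_def)
qed

text \<open>The \<open>esym_ratio\<close>s are the coefficients of the Lagrange basis polynomials at the nodes \<open>a\<close>,
  so they form the inverse of the Vandermonde matrix.\<close>
lemma sum_esym_ratio_power:
  assumes inj: "inj_on a {..<N}" and "c < N" "d < N"
  shows "(\<Sum>j<N. esym_ratio N a c (N - Suc j) * a d ^ j) = (if c = d then 1 else 0)"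
proof -
  have "(\<Sum>j<N. esym_ratio N a c (N - Suc j) * a d ^ j) =
      (\<Prod>h\<in>{..<N} - {c}. a d - a h) / (\<Prod>h\<in>{..<N} - {c}. a c - a h)"
    using sum_esym_without[OF \<open>c < N\<close>, of a "a d"]
    by (simp add: esym_ratio_def sum_divide_distrib[symmetric])
  moreover have "(\<Prod>h\<in>{..<N} - {c}. a c - a h) \<noteq> 0"
    using assms by (auto dest: inj_onD)
  moreover have "(\<Prod>h\<in>{..<N} - {c}. a d - a h) = 0" if "c \<noteq> d"
    using that \<open>d < N\<close> by auto
  ultimately show ?thesis by auto
qed

text \<open>A left inverse of a square matrix is a right inverse. Summation over exponents is
  interpolation; the pairing of moments needs this summation over nodes.\<close>

lemma sum_power_esym_ratio:
  assumes inj: "inj_on a {..<N}" and "i < N" "j < N"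
  shows "(\<Sum>c<N. a c ^ i * esym_ratio N a c (N - Suc j)) = (if i = j then 1 else 0)"
proof -
  define E where "E = Matrix.mat N N (\<lambda>(c, j). esym_ratio N a c (N - Suc j))"
  define V where "V = Matrix.mat N N (\<lambda>(i, c). a c ^ i)"
  have "E * V = 1\<^sub>m N"
    using sum_esym_ratio_power[OF inj]
    by (intro eq_matI) (auto simp: E_def V_def scalar_prod_def atLeast0LessThan)
  then have "V * E = 1\<^sub>m N"
    by (rule mat_mult_left_right_inverse[rotated 2]) (auto simp: E_def V_def)
  then have "(V * E) $$ (i, j) = 1\<^sub>m N $$ (i, j)"
    by simp
  then show ?thesis
    using assms by (simp add: E_def V_def scalar_prod_def atLeast0LessThan)
qed

text \<open>The shift \<open>r\<close> treats both regimes at once: it is 0 for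
  \<open>n2 \<le> n1\<close> and \<open>n2 - n1\<close> otherwise. Moments
  \<open>a c ^ (i + r)\<close> meet the inverse Vandermonde column \<open>j + r\<close>, because
  \<open>n - Suc j = N - Suc (j + r)\<close>.\<close>

lemma has_bochner_integral_dual_weight:
  fixes w :: "nat \<Rightarrow> real \<Rightarrow> real"
  assumes inj: "inj_on a {..<N}" and N: "n + r = N"
    and w: "\<And>i c. i < n \<Longrightarrow> c < N \<Longrightarrow>
      has_bochner_integral lborel (\<lambda>t. t ^ i * w c t) (a c ^ (i + r) * C i)"
    and "i < n" "j < n" "C j \<noteq> 0"
  shows "has_bochner_integral lborel
    (\<lambda>t. t ^ i * (1 / C j * (\<Sum>c<N. esym_ratio N a c (n - Suc j) * w c t))) (if i = j then 1 else 0)"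
proof -
  have "has_bochner_integral lborel
      (\<lambda>t. \<Sum>c<N. (1 / C j * esym_ratio N a c (n - Suc j)) * (t ^ i * w c t))
      (\<Sum>c<N. (1 / C j * esym_ratio N a c (n - Suc j)) * (a c ^ (i + r) * C i))"
    using w \<open>i < n\<close> by (intro has_bochner_integral_sum has_bochner_integral_mult_right) auto
  moreover have "(\<Sum>c<N. (1 / C j * esym_ratio N a c (n - Suc j)) * (a c ^ (i + r) * C i)) =
      C i / C j * (\<Sum>c<N. a c ^ (i + r) * esym_ratio N a c (N - Suc (j + r)))"
  proof -
    have "n - Suc j = N - Suc (j + r)"
      using N by simp
    then show ?thesis
      by (simp add: sum_distrib_left mult_ac)
  qed
  moreover have "(\<Sum>c<N. a c ^ (i + r) * esym_ratio N a c (N - Suc (j + r))) = (if i = j then 1 else 0)"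
    using assms by (subst sum_power_esym_ratio[OF inj]) auto
  ultimately show ?thesis
    using \<open>C j \<noteq> 0\<close> by (auto simp: sum_distrib_left mult_ac)
qed

text \<open>Integrating a vanishing combination against \<open>q i\<close> isolates its
  \<open>i\<close>-th coefficient. Duality is symmetric, so this serves the monomials and the
  \<open>q j\<close> alike.\<close>

lemma fun_independent_if_dual:
  fixes p q :: "nat \<Rightarrow> real \<Rightarrow> real"
  assumes bi: "\<And>i j. i < n \<Longrightarrow> j < n \<Longrightarrow>
      has_bochner_integral lborel (\<lambda>t. p j t * q i t) (if j = i then 1 else 0)"
  shows "fun_independent n p"
  unfolding fun_independent_def
proof (intro allI impI)
  fix \<gamma> i assume 0: "\<forall>x. (\<Sum>j<n. \<gamma> j * p j x) = 0" and i: "i < n"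
  have "has_bochner_integral lborel (\<lambda>t. \<Sum>j<n. \<gamma> j * (p j t * q i t))
      (\<Sum>j<n. \<gamma> j * (if j = i then 1 else 0))"
    using bi i by (intro has_bochner_integral_sum has_bochner_integral_mult_right) auto
  moreover have "(\<Sum>j<n. \<gamma> j * (p j t * q i t)) = (\<Sum>j<n. \<gamma> j * p j t) * q i t" for t
    by (simp add: sum_distrib_right mult.assoc)
  moreover have "(\<Sum>j<n. \<gamma> j * (if j = i then 1 else 0)) = \<gamma> i"
    using i by (simp add: if_distrib cong: if_cong)
  ultimately have "has_bochner_integral lborel (\<lambda>t::real. 0) (\<gamma> i)"
    using 0 by simp
  then show "\<gamma> i = 0"
    by (simp add: has_bochner_integral_iff)
qed

lemma bi_orthonormalI:
  assumes bi: "\<And>i j. i < n \<Longrightarrow> j < n \<Longrightarrow>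
      has_bochner_integral lborel (\<lambda>t. t ^ j * q i t) (if j = i then 1 else 0)"
    and span: "fun_span n q = fun_span n w"
  shows "bi_orthonormal n w (\<lambda>j t. t ^ j) q"
proof -
  have "fun_independent n (\<lambda>j t. t ^ j :: real)"
    by (rule fun_independent_if_dual[OF bi])
  moreover have "fun_independent n q"
  proof (rule fun_independent_if_dual)
    fix i j assume "i < n" "j < n"
    then show "has_bochner_integral lborel (\<lambda>t. q j t * t ^ i) (if j = i then 1 else 0)"
      using bi[of j i] by (simp add: mult.commute eq_commute)
  qed
  ultimately show ?thesis
    using bi span by (simp add: bi_orthonormal_def basis_of_span_def)
qed

lemma mem_fun_span: "b < n \<Longrightarrow> u b \<in> fun_span n u"
  unfolding fun_span_def
  by (rule CollectI, rule exI[of _ "\<lambda>j. if j = b then 1 else 0"])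
     (simp add: if_distrib[of "\<lambda>x. x * _"] cong: if_cong)

lemma fun_span_subset:
  assumes "\<And>j x. j < n \<Longrightarrow> u j x = (\<Sum>b<n. C j b * v b x)"
  shows "fun_span n u \<subseteq> fun_span n v"
proof
  fix f assume "f \<in> fun_span n u"
  then obtain \<gamma> where "f = (\<lambda>x. \<Sum>j<n. \<gamma> j * u j x)"
    by (auto simp: fun_span_def)
  then have "f = (\<lambda>x. \<Sum>j<n. \<Sum>b<n. \<gamma> j * C j b * v b x)"
    using assms by (simp add: sum_distrib_left mult_ac)
  also have "\<dots> = (\<lambda>x. \<Sum>b<n. (\<Sum>j<n. \<gamma> j * C j b) * v b x)"
    by (subst sum.swap) (simp add: sum_distrib_right)
  finally show "f \<in> fun_span n v"
    by (auto simp: fun_span_def)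
qed

section \<open>Normalisation and correlation functions of the polynomial density\<close>

lemma mellin_sgn_eq_moment:
  assumes [measurable]: "w \<in> borel_measurable borel"
  shows "mellin_sgn w (real (c + 1)) c = (LINT x|lborel. x ^ c * w x)"
  unfolding mellin_sgn_def
proof (rule integral_cong_AE)
  have nz: "sgn x ^ (c mod 2) * \<bar>x\<bar> powr real (c + 1) * w x / \<bar>x\<bar> = x ^ c * w x" if "x \<noteq> 0" for x :: real
  proof -
    have "\<bar>x\<bar> powr real (c + 1) = \<bar>x\<bar> * \<bar>x\<bar> ^ c"
      using that by (subst powr_realpow) auto
    moreover have "sgn x ^ (c mod 2) * \<bar>x\<bar> ^ c = x ^ c"
      using that by (cases "even c") (auto simp: odd_iff_mod_2_eq_one power_even_abs
          sgn_if abs_if power_minus_odd even_iff_mod_2_eq_zero)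
    ultimately show ?thesis
      using that by (simp add: mult_ac)
  qed
  \<comment> \<open>The point 0 must be left out: there the left side is 0, but for
    \<open>c = 0\<close> the right side is \<open>w 0\<close>.\<close>
  show "AE x in lborel. sgn x ^ (c mod 2) * \<bar>x\<bar> powr real (c + 1) * w x / \<bar>x\<bar> = x ^ c * w x"
    using AE_lborel_singleton[of 0] by eventually_elim (rule nz)
qed measurable

text \<open>Dividing the determinant of the weights by that of their moments turns it into the
  determinant of the \<open>q j\<close>, whichever basis of the span the weights are. Its product
  with the Vandermonde determinant is the determinant of the kernel.\<close>

lemma bi_orthonormal_polynomial_density:
  assumes "bi_orthonormal n w (\<lambda>j t. t ^ j) q"
  shows "polynomial_density n w x = 1 / fact n * det_n n (\<lambda>b c. kernel n (\<lambda>j t. t ^ j) q (x b) (x c))"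
proof -
  have span: "fun_span n q = fun_span n w"
    and bi: "\<And>i j. i < n \<Longrightarrow> j < n \<Longrightarrow>
      has_bochner_integral lborel (\<lambda>t. t ^ j * q i t) (if j = i then 1 else 0)"
    using assms by (auto simp: bi_orthonormal_def basis_of_span_def)
  have "\<exists>\<gamma>. q j = (\<lambda>x. \<Sum>b<n. \<gamma> b * w b x)" if "j < n" for j
    using mem_fun_span[OF that, of q] span by (auto simp: fun_span_def)
  then obtain C where C: "\<And>j. j < n \<Longrightarrow> q j = (\<lambda>x. \<Sum>b<n. C j b * w b x)"
    by metis
  have "\<exists>\<gamma>. w b = (\<lambda>x. \<Sum>j<n. \<gamma> j * q j x)" if "b < n" for b
    using mem_fun_span[OF that, of w] span by (auto simp: fun_span_def)
  then obtain B where B: "\<And>b. b < n \<Longrightarrow> w b = (\<lambda>x. \<Sum>j<n. B b j * q j x)"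
    by metis
  \<comment> \<open>Duality with the monomials reads the coefficients \<open>B b c\<close> off as
    moments.\<close>
  have moment: "has_bochner_integral lborel (\<lambda>t. t ^ c * w b t) (B b c)" if "b < n" "c < n" for b c
  proof -
    have "has_bochner_integral lborel (\<lambda>t. \<Sum>j<n. B b j * (t ^ c * q j t))
        (\<Sum>j<n. B b j * (if c = j then 1 else 0))"
      using bi that by (intro has_bochner_integral_sum has_bochner_integral_mult_right) auto
    moreover have "(\<Sum>j<n. B b j * (if c = j then 1 else 0)) = B b c"
      using that by (simp add: if_distrib cong: if_cong)
    moreover have "t ^ c * w b t = (\<Sum>j<n. B b j * (t ^ c * q j t))" for t
      by (simp add: B[OF \<open>b < n\<close>] sum_distrib_left mult_ac)
    ultimately show ?thesis
      by simp
  qed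
  have G: "mellin_sgn (w b) (real (c + 1)) c = B b c" if "b < n" "c < n" for b c
  proof -
    have "w b \<in> borel_measurable borel"
      using moment[of b 0] that by (auto simp: has_bochner_integral_iff)
    then show ?thesis
      using moment[OF that] by (simp only: mellin_sgn_eq_moment has_bochner_integral_iff)
  qed
  have "(\<Sum>b<n. C i b * B b j) = (if i = j then 1 else 0)" if "i < n" "j < n" for i j
  proof -
    have "has_bochner_integral lborel (\<lambda>t. \<Sum>b<n. C i b * (t ^ j * w b t)) (\<Sum>b<n. C i b * B b j)"
      using moment that by (intro has_bochner_integral_sum has_bochner_integral_mult_right) auto
    moreover have "t ^ j * q i t = (\<Sum>b<n. C i b * (t ^ j * w b t))" for t
      by (simp add: C[OF \<open>i < n\<close>] sum_distrib_left mult_ac)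
    ultimately show ?thesis
      using bi[OF that] by (auto simp: has_bochner_integral_iff)
  qed
  then have "det_n n C * det_n n B = 1"
    using det_n_mult[of n C B] det_n_cong[of n "\<lambda>i j. \<Sum>b<n. C i b * B b j" "\<lambda>i j. if i = j then 1 else 0"]
    by (simp add: det_n_one)
  \<comment> \<open>\<open>C\<close> and \<open>B\<close> are inverse base changes, so
    \<open>1 / det_n n B\<close> is \<open>det_n n C\<close>.\<close>
  then have "X / det_n n B = det_n n C * X" for X
    by (auto simp: divide_eq_eq mult_ac)
  moreover have "det_n n (\<lambda>j c. q j (x c)) = det_n n C * det_n n (\<lambda>b c. w b (x c))"
    unfolding det_n_mult[symmetric] by (rule det_n_cong) (simp add: C)
  moreover have "det_n n (\<lambda>b c. mellin_sgn (w b) (real (c + 1)) c) = det_n n B"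
    by (rule det_n_cong) (rule G)
  moreover have "det_n n (\<lambda>b c. kernel n (\<lambda>j t. t ^ j) q (x b) (x c)) =
      vandermonde n x * det_n n (\<lambda>j c. q j (x c))"
    unfolding kernel_def det_n_vandermonde[symmetric] by (rule det_n_mult)
  ultimately show ?thesis
    by (simp add: polynomial_density_def)
qed

lemma bi_orthonormal_is_correlation_kernel:
  assumes "bi_orthonormal n w (\<lambda>j t. t ^ j) q"
  shows "is_correlation_kernel n (polynomial_density n w) (kernel n (\<lambda>j t. t ^ j) q)"
  unfolding is_correlation_kernel_def
proof (intro ballI allI)
  fix \<kappa> and a :: "nat \<Rightarrow> real"
  assume \<kappa>: "\<kappa> \<in> {1..n}"
  have "has_bochner_integral (PiM {\<kappa>..<n} (\<lambda>_. lborel))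
      (\<lambda>z. det_n n (\<lambda>b c. kernel n (\<lambda>j t. t ^ j) q (if b < \<kappa> then a b else z b) (if c < \<kappa> then a c else z c)))
      (fact (n - \<kappa>) * det_n \<kappa> (\<lambda>b c. kernel n (\<lambda>j t. t ^ j) q (a b) (a c)))"
    by (rule has_bochner_integral_det_n_kernel)
       (use assms \<kappa> in \<open>auto simp: bi_orthonormal_def\<close>)
  \<comment> \<open>The factor is \<open>fact n / fact (n - \<kappa>)\<close> times the
    \<open>1 / fact n\<close> of the density.\<close>
  from has_bochner_integral_mult_right[OF this, of "1 / fact (n - \<kappa>)"]
  show "has_bochner_integral (PiM {\<kappa>..<n} (\<lambda>_. lborel))
      (\<lambda>z. fact n / fact (n - \<kappa>) * polynomial_density n w (\<lambda>i. if i < \<kappa> then a i else z i))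
      (det_n \<kappa> (\<lambda>b c. kernel n (\<lambda>j t. t ^ j) q (a b) (a c)))"
    by (simp add: bi_orthonormal_polynomial_density[OF assms])
qed

section \<open>The two families of weights and their dual functions\<close>

lemma polya_ensemble_mellin_nonzero:
  assumes "polya_ensemble M n \<omega> g" "1 \<le> j" "j \<le> n"
  shows "mellin \<omega> (real j) \<noteq> 0"
proof
  assume "mellin \<omega> (real j) = 0"
  then have "(\<Prod>j=1..n. fact j * mellin \<omega> (real j)) = 0"
    using assms(2,3) by (auto intro!: bexI[of _ j])
  \<comment> \<open>Division by zero yields 0, so a vanishing Mellin moment would make the density
    identically zero, against total mass 1.\<close>
  then have "polya_density n \<omega> = (\<lambda>_. 0)"
    by (simp add: polya_density_def fun_eq_iff)
  with assms(1) show False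
    by (simp add: polya_ensemble_def squared_singular_value_density_def unordered_density_def Let_def)
qed

lemma has_bochner_integral_mellin:
  assumes "\<omega> \<in> L1_class k {0<..}" "i \<le> k"
  shows "has_bochner_integral lborel (\<lambda>u. u ^ i * (indicator {0<..} u * \<omega> u)) (mellin \<omega> (real (i + 1)))"
proof -
  have "set_integrable lborel {0<..} (\<lambda>x. \<bar>x\<bar> powr real i * \<omega> x)"
    using assms by (auto simp: L1_class_def)
  moreover have "indicator {0<..} x *\<^sub>R (\<bar>x\<bar> powr real i * \<omega> x) = x ^ i * (indicator {0<..} x * \<omega> x)" for x
    by (auto simp: indicator_def powr_realpow)
  moreover have "indicator {0<..} x *\<^sub>R (x powr (real (i + 1) - 1) * \<omega> x) = x ^ i * (indicator {0<..} x * \<omega> x)" for x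
    by (auto simp: indicator_def powr_realpow)
  ultimately show ?thesis
    by (simp only: has_bochner_integral_iff mellin_def set_lebesgue_integral_def set_integrable_def)
qed

lemma L1_class_measurable:
  assumes "\<omega> \<in> L1_class k {0<..}"
  shows "(\<lambda>u. indicator {0<..} u * \<omega> u) \<in> borel_measurable borel"
  using has_bochner_integral_mellin[OF assms, of 0] by (auto simp: has_bochner_integral_iff)

lemma has_bochner_integral_weight_ge:
  assumes \<omega>: "\<omega> \<in> L1_class (n1 - 1) {0<..}" and \<alpha>: "\<alpha> \<noteq> 0"
    and n: "i < n2" "n2 \<le> n1" "n1 \<le> m"
  shows "has_bochner_integral lborel (\<lambda>t. t ^ i * weight_ge m n1 n2 \<omega> \<alpha> t)
    (\<alpha> ^ i * (fact (m - n1) * fact (n1 + i - n2) / fact (m + i - n2) * mellin \<omega> (real (n1 + i - n2 + 1))))"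
proof -
  \<comment> \<open>The factor \<open>(t / \<alpha>) ^ (n1 - n2)\<close> raises the order of the
    moment from \<open>i\<close> to \<open>e\<close>. The bound \<open>i < n2\<close> keeps it at
    most \<open>n1 - 1\<close>, the last order granted by the class of
    \<open>\<omega>\<close>.\<close>
  define e where "e = i + (n1 - n2)"
  have e: "e = n1 + i - n2" "e + (m - n1) = m + i - n2" "e \<le> n1 - 1"
    using n by (auto simp: e_def)
  have pow: "t ^ i * weight_ge m n1 n2 \<omega> \<alpha> t = 1 / \<alpha> ^ (n1 - n2) * (t ^ e * (heaviside (t * \<alpha>) *
      omega0_integral (m - n1) (\<lambda>s. 1 / (\<bar>\<alpha>\<bar> * s) * \<omega> (t / (\<alpha> * s)))))" for t
    by (simp add: weight_ge_def e_def power_add power_divide)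
  have val: "1 / \<alpha> ^ (n1 - n2) * (\<alpha> ^ e * I) = \<alpha> ^ i * I" for I
    using \<alpha> by (simp add: e_def power_add)
  show ?thesis
    using has_bochner_integral_mult_right[OF has_bochner_integral_scaled_weight[OF
        has_bochner_integral_mellin[OF \<omega> e(3)] L1_class_measurable[OF \<omega>] \<alpha>, of "m - n1"],
        of "1 / \<alpha> ^ (n1 - n2)"]
    unfolding pow val e(2) unfolding e(1) .
qed

lemma has_bochner_integral_weight_lt:
  assumes \<omega>: "\<omega> \<in> L1_class (n1 - 1) {0<..}" and \<alpha>: "\<alpha> \<noteq> 0"
    and n: "i < n1" "n1 \<le> m"
  shows "has_bochner_integral lborel (\<lambda>t. t ^ i * weight_lt m n1 n2 \<omega> \<alpha> t)
    (\<alpha> ^ (i + (n2 - n1)) * (fact (m - n1) * fact i / fact (m + i - n1) * mellin \<omega> (real (i + 1))))"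
proof -
  have e: "i + (m - n1) = m + i - n1" "i \<le> n1 - 1"
    using n by auto
  have pow: "t ^ i * weight_lt m n1 n2 \<omega> \<alpha> t = \<alpha> ^ (n2 - n1) * (t ^ i * (heaviside (t * \<alpha>) *
      omega0_integral (m - n1) (\<lambda>s. 1 / (\<bar>\<alpha>\<bar> * s) * \<omega> (t / (\<alpha> * s)))))" for t
    by (simp add: weight_lt_def)
  have val: "\<alpha> ^ (n2 - n1) * (\<alpha> ^ i * I) = \<alpha> ^ (i + (n2 - n1)) * I" for I
    by (simp add: power_add)
  show ?thesis
    using has_bochner_integral_mult_right[OF has_bochner_integral_scaled_weight[OF
        has_bochner_integral_mellin[OF \<omega> e(2)] L1_class_measurable[OF \<omega>] \<alpha>, of "m - n1"],
        of "\<alpha> ^ (n2 - n1)"]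
    unfolding pow val e(1) .
qed

lemma bi_orthonormal_ge:
  assumes \<omega>: "\<omega> \<in> L1_class (n1 - 1) {0<..}"
    and mellin: "\<And>j. 1 \<le> j \<Longrightarrow> j \<le> n1 \<Longrightarrow> mellin \<omega> (real j) \<noteq> 0"
    and a: "inj_on a {..<n2}" "\<And>c. c < n2 \<Longrightarrow> a c \<noteq> 0"
    and n: "n2 \<le> n1" "n1 \<le> m"
  shows "bi_orthonormal n2 (weights_ge m n1 n2 \<omega> a) (\<lambda>j t. t ^ j) (q_ge m n1 n2 \<omega> a)"
proof -
  define C where "C j = fact (m - n1) * fact (n1 + j - n2) / fact (m + j - n2) *
    mellin \<omega> (real (n1 + j - n2 + 1))" for j
  have C: "C j \<noteq> 0" if "j < n2" for j
    using mellin[of "n1 + j - n2 + 1"] that n by (simp add: C_def)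
  have q: "q_ge m n1 n2 \<omega> a j = (\<lambda>t. 1 / C j *
      (\<Sum>c<n2. esym_ratio n2 a c (n2 - Suc j) * weights_ge m n1 n2 \<omega> a c t))" for j
    by (simp add: q_ge_def C_def weights_ge_def fun_eq_iff sum_divide_distrib[symmetric])
  \<comment> \<open>Lagrange interpolation at the nodes inverts the definition of the
    \<open>q j\<close>, which gives the inclusion of spans that is not visible from it.\<close>
  have w: "weights_ge m n1 n2 \<omega> a d t = (\<Sum>j<n2. C j * a d ^ j * q_ge m n1 n2 \<omega> a j t)"
    if "d < n2" for d t
  proof -
    have "(\<Sum>j<n2. C j * a d ^ j * q_ge m n1 n2 \<omega> a j t) =
        (\<Sum>j<n2. \<Sum>c<n2. esym_ratio n2 a c (n2 - Suc j) * a d ^ j * weights_ge m n1 n2 \<omega> a c t)"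
      using C by (intro sum.cong refl) (simp add: q sum_distrib_left mult_ac)
    also have "\<dots> = (\<Sum>c<n2. (\<Sum>j<n2. esym_ratio n2 a c (n2 - Suc j) * a d ^ j) * weights_ge m n1 n2 \<omega> a c t)"
      by (subst sum.swap) (simp add: sum_distrib_right)
    also have "\<dots> = weights_ge m n1 n2 \<omega> a d t"
      using that by (simp add: sum_esym_ratio_power[OF a(1)] if_distrib[of "\<lambda>x. x * _"] cong: if_cong)
    finally show ?thesis ..
  qed
  show ?thesis
  proof (rule bi_orthonormalI)
    fix i j assume "i < n2" "j < n2"
    moreover have "has_bochner_integral lborel (\<lambda>t. t ^ i * weights_ge m n1 n2 \<omega> a c t)
        (a c ^ (i + 0) * C i)" if "i < n2" "c < n2" for i c
      unfolding C_def weights_ge_def add_0_right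
      using that a n by (intro has_bochner_integral_weight_ge[OF \<omega>]) auto
    ultimately show "has_bochner_integral lborel (\<lambda>t. t ^ j * q_ge m n1 n2 \<omega> a i t) (if j = i then 1 else 0)"
      unfolding q using C n
      by (intro has_bochner_integral_dual_weight[OF a(1), where r = 0]) auto
  next
    show "fun_span n2 (q_ge m n1 n2 \<omega> a) = fun_span n2 (weights_ge m n1 n2 \<omega> a)"
    proof
      show "fun_span n2 (weights_ge m n1 n2 \<omega> a) \<subseteq> fun_span n2 (q_ge m n1 n2 \<omega> a)"
        using w by (rule fun_span_subset)
      show "fun_span n2 (q_ge m n1 n2 \<omega> a) \<subseteq> fun_span n2 (weights_ge m n1 n2 \<omega> a)"
        by (rule fun_span_subset[where C = "\<lambda>j c. 1 / C j * esym_ratio n2 a c (n2 - Suc j)"])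
           (simp add: q sum_distrib_left mult_ac)
    qed
  qed
qed

text \<open>Here the Lagrange coefficients already sit in the weights of the ensemble, so
  \<open>q_lt\<close> is a non-zero multiple of \<open>weights_lt\<close> for each index and
  equality of spans is a rescaling. Duality still rests on all \<open>n2\<close> nodes.\<close>

lemma bi_orthonormal_lt:
  assumes \<omega>: "\<omega> \<in> L1_class (n1 - 1) {0<..}"
    and mellin: "\<And>j. 1 \<le> j \<Longrightarrow> j \<le> n1 \<Longrightarrow> mellin \<omega> (real j) \<noteq> 0"
    and a: "inj_on a {..<n2}" "\<And>c. c < n2 \<Longrightarrow> a c \<noteq> 0"
    and n: "n1 < n2" "n1 \<le> m"
  shows "bi_orthonormal n1 (weights_lt m n1 n2 \<omega> a) (\<lambda>j t. t ^ j) (q_lt m n1 n2 \<omega> a)"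
proof -
  define C where "C j = fact (m - n1) * fact j / fact (m + j - n1) * mellin \<omega> (real (j + 1))" for j
  have C: "C j \<noteq> 0" if "j < n1" for j
    using mellin[of "j + 1"] that by (simp add: C_def)
  have q: "q_lt m n1 n2 \<omega> a j = (\<lambda>t. 1 / C j *
      (\<Sum>c<n2. esym_ratio n2 a c (n1 - Suc j) * weight_lt m n1 n2 \<omega> (a c) t))" for j
    by (simp add: q_lt_def C_def fun_eq_iff sum_divide_distrib[symmetric])
  have qw: "q_lt m n1 n2 \<omega> a j t = 1 / C j * weights_lt m n1 n2 \<omega> a j t" for j t
    by (simp add: q weights_lt_def)
  show ?thesis
  proof (rule bi_orthonormalI)
    fix i j assume "i < n1" "j < n1"
    moreover have "has_bochner_integral lborel (\<lambda>t. t ^ i * weight_lt m n1 n2 \<omega> (a c) t)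
        (a c ^ (i + (n2 - n1)) * C i)" if "i < n1" "c < n2" for i c
      unfolding C_def using that a n by (intro has_bochner_integral_weight_lt[OF \<omega>]) auto
    ultimately show "has_bochner_integral lborel (\<lambda>t. t ^ j * q_lt m n1 n2 \<omega> a i t) (if j = i then 1 else 0)"
      unfolding q using C n
      by (intro has_bochner_integral_dual_weight[OF a(1), where r = "n2 - n1"]) auto
  next
    show "fun_span n1 (q_lt m n1 n2 \<omega> a) = fun_span n1 (weights_lt m n1 n2 \<omega> a)"
    proof
      show "fun_span n1 (weights_lt m n1 n2 \<omega> a) \<subseteq> fun_span n1 (q_lt m n1 n2 \<omega> a)"
        using C by (intro fun_span_subset[where C = "\<lambda>j c. if c = j then C j else 0"])
          (simp add: qw if_distrib[of "\<lambda>x. x * _"] if_distrib[of "\<lambda>x. x / _"] cong: if_cong)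
      show "fun_span n1 (q_lt m n1 n2 \<omega> a) \<subseteq> fun_span n1 (weights_lt m n1 n2 \<omega> a)"
        by (intro fun_span_subset[where C = "\<lambda>j c. if c = j then 1 / C j else 0"])
          (simp add: qw if_distrib[of "\<lambda>x. x * _"] cong: if_cong)
    qed
  qed
qed

text \<open>The law of the eigenvalues of \<open>g s ** x ** hadj (g s)\<close> is the background
  result on which the kernel statement builds; it enters as the premise of the last conjunct in each
  regime and supplies the density that witnesses \<open>has_eigenvalue_kernel\<close>.\<close>

theorem mainTheorem2:
  fixes M :: "'s measure"
    and g :: "'s \<Rightarrow> complex ^ 'm ^ 'l"
    and x :: "complex ^ 'm ^ 'm"
    and \<omega> :: "real \<Rightarrow> real"
    and a :: "nat \<Rightarrow> real"
    and m n1 n2 :: nat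
  assumes m: "m = CARD('m)"
    and n1: "0 < n1" "n1 \<le> CARD('l)" "n1 \<le> m"
    and n2: "0 < n2" "n2 \<le> m"
    and g: "polya_ensemble M n1 \<omega> g"
    and x: "x \<in> H_set n2" "nonzero_eigenvalues n2 x a" "inj_on a {..<n2}"
  shows
    "(n2 \<le> n1 \<longrightarrow>
       bi_orthonormal n2 (weights_ge m n1 n2 \<omega> a) (\<lambda>j t. t ^ j) (q_ge m n1 n2 \<omega> a) \<and>
       (\<forall>t1 t2. kernel n2 (\<lambda>j t. t ^ j) (q_ge m n1 n2 \<omega> a) t1 t2 =
          (\<Sum>j<n2. \<Sum>c<n2. fact (m + j - n2) / (fact (m - n1) * fact (n1 + j - n2)) *
             (esym_without n2 a c (n2 - j - 1) / (\<Prod>h\<in>{..<n2} - {c}. a c - a h)) *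
             (t1 ^ j * weight_ge m n1 n2 \<omega> (a c) t2 / mellin \<omega> (real (n1 + j - n2 + 1))))) \<and>
       is_correlation_kernel n2 (polynomial_density n2 (weights_ge m n1 n2 \<omega> a))
         (kernel n2 (\<lambda>j t. t ^ j) (q_ge m n1 n2 \<omega> a)) \<and>
       (polynomial_ensemble M n2 (weights_ge m n1 n2 \<omega> a) (\<lambda>s. g s ** x ** hadj (g s)) \<longrightarrow>
          has_eigenvalue_kernel M n2 (\<lambda>s. g s ** x ** hadj (g s))
            (kernel n2 (\<lambda>j t. t ^ j) (q_ge m n1 n2 \<omega> a)))) \<and>
     (n1 < n2 \<longrightarrow>
       bi_orthonormal n1 (weights_lt m n1 n2 \<omega> a) (\<lambda>j t. t ^ j) (q_lt m n1 n2 \<omega> a) \<and>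
       (\<forall>t1 t2. kernel n1 (\<lambda>j t. t ^ j) (q_lt m n1 n2 \<omega> a) t1 t2 =
          (\<Sum>j<n1. \<Sum>c<n2. fact (m + j - n1) / (fact (m - n1) * fact j) *
             (esym_without n2 a c (n1 - j - 1) / (\<Prod>h\<in>{..<n2} - {c}. a c - a h)) *
             (t1 ^ j * weight_lt m n1 n2 \<omega> (a c) t2 / mellin \<omega> (real (j + 1))))) \<and>
       is_correlation_kernel n1 (polynomial_density n1 (weights_lt m n1 n2 \<omega> a))
         (kernel n1 (\<lambda>j t. t ^ j) (q_lt m n1 n2 \<omega> a)) \<and>
       (polynomial_ensemble M n1 (weights_lt m n1 n2 \<omega> a) (\<lambda>s. g s ** x ** hadj (g s)) \<longrightarrow>
          has_eigenvalue_kernel M n1 (\<lambda>s. g s ** x ** hadj (g s))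
            (kernel n1 (\<lambda>j t. t ^ j) (q_lt m n1 n2 \<omega> a))))"
proof -
  have \<omega>: "\<omega> \<in> L1_class (n1 - 1) {0<..}"
    using g by (simp add: polya_ensemble_def polya_class_def)
  have a0: "a c \<noteq> 0" if "c < n2" for c
    using x(2) that by (simp add: nonzero_eigenvalues_def)
  have ge: "bi_orthonormal n2 (weights_ge m n1 n2 \<omega> a) (\<lambda>j t. t ^ j) (q_ge m n1 n2 \<omega> a)"
    if "n2 \<le> n1"
    using that n1(3) a0 x(3) polya_ensemble_mellin_nonzero[OF g] by (intro bi_orthonormal_ge[OF \<omega>]) auto
  have lt: "bi_orthonormal n1 (weights_lt m n1 n2 \<omega> a) (\<lambda>j t. t ^ j) (q_lt m n1 n2 \<omega> a)"
    if "n1 < n2"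
    using that n1(3) a0 x(3) polya_ensemble_mellin_nonzero[OF g] by (intro bi_orthonormal_lt[OF \<omega>]) auto
  show ?thesis
  proof (intro conjI impI allI)
    fix t1 t2
    show "kernel n2 (\<lambda>j t. t ^ j) (q_ge m n1 n2 \<omega> a) t1 t2 =
        (\<Sum>j<n2. \<Sum>c<n2. fact (m + j - n2) / (fact (m - n1) * fact (n1 + j - n2)) *
           (esym_without n2 a c (n2 - j - 1) / (\<Prod>h\<in>{..<n2} - {c}. a c - a h)) *
           (t1 ^ j * weight_ge m n1 n2 \<omega> (a c) t2 / mellin \<omega> (real (n1 + j - n2 + 1))))"
      by (simp add: kernel_def q_ge_def esym_ratio_def sum_distrib_left mult_ac)
    show "kernel n1 (\<lambda>j t. t ^ j) (q_lt m n1 n2 \<omega> a) t1 t2 =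
        (\<Sum>j<n1. \<Sum>c<n2. fact (m + j - n1) / (fact (m - n1) * fact j) *
           (esym_without n2 a c (n1 - j - 1) / (\<Prod>h\<in>{..<n2} - {c}. a c - a h)) *
           (t1 ^ j * weight_lt m n1 n2 \<omega> (a c) t2 / mellin \<omega> (real (j + 1))))"
      by (simp add: kernel_def q_lt_def esym_ratio_def sum_distrib_left mult_ac)
  qed (use ge lt in \<open>auto simp: has_eigenvalue_kernel_def polynomial_ensemble_def
      intro: bi_orthonormal_is_correlation_kernel\<close>)
qed

end
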